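(* Let $m,n\in\mathbb{N}$ with $n>2$. If $(B_q)_{q=1}^\infty$ is a sequence of balls in $\mathbb{R}^m$ such that \[ \sum_{\mathbf{q}\in\mathbb{Z}^n\setminus\{\mathbf{0}\}}\left(\frac{\varphi(\gcd(\mathbf{q}))}{\gcd(\mathbf{q})}\right)^m|B_{|\mathbf{q}|}|=\infty, \] then for almost every $\mathbf{x}\in\operatorname{Mat}_{n\times m}(\mathbb{R})$ there exist infinitely many $(\mathbf{p},\mathbf{q})\in\mathbb{Z}^m\times\mathbb{Z}^n$ with $\gcd(p_i,\mathbf{q})=1$ for every $i=1,\dots,m$ and $\mathbf{q}\mathbf{x}-\mathbf{p}\in B_{|\mathbf{q}|}$. Conversely, if this sum converges, then for almost every $\mathbf{x}$ there are only finitely many such $(\mathbf{p},\mathbf{q})$.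
   Context: $\varphi$ is Euler's totient; $\gcd(\mathbf{q})=\gcd(q_1,\dots,q_n)$ and $\gcd(p_i,\mathbf{q})=\gcd(p_i,q_1,\dots,q_n)$. $|B|$ is Lebesgue measure; $\mathbf{q}$ is a row vector and $|\mathbf{q}|$ its maximum norm. "Almost every" refers to Lebesgue measure. *)

theory Defs
  imports "HOL-Analysis.Analysis" "HOL-Number_Theory.Totient"
begin

definition max_norm :: "int ^ 'n \<Rightarrow> nat" where
  "max_norm q = nat (Max (range (\<lambda>i. \<bar>q $ i\<bar>)))"

definition gcd_vec :: "int ^ 'n \<Rightarrow> nat" where
  "gcd_vec q = nat (Gcd (range (\<lambda>i. q $ i)))"

definition real_vec :: "int ^ 'n \<Rightarrow> real ^ 'n" where
  "real_vec q = (\<chi> i. real_of_int (q $ i))"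

text \<open>
  Balls may be open or closed; radius \<open>0\<close> (the empty set or a single point) is allowed.
  The norm is a parameter so that both Euclidean balls (\<open>N = norm\<close>) and maximum-norm balls
  (\<open>N = infnorm\<close>) are available.
\<close>

definition is_ball :: "(real ^ 'm \<Rightarrow> real) \<Rightarrow> (real ^ 'm) set \<Rightarrow> bool" where
  "is_ball N S \<longleftrightarrow>
     (\<exists>c r. 0 \<le> r \<and> (S = {y. N (y - c) < r} \<or> S = {y. N (y - c) \<le> r}))"

definition measure_sum :: "'n::finite itself \<Rightarrow> (nat \<Rightarrow> (real ^ 'm) set) \<Rightarrow> ennreal" where
  "measure_sum _ B =
     (\<Sum>\<^sub>\<infinity>q\<in>UNIV - {0 :: int ^ 'n}.
        ennreal ((real (totient (gcd_vec q)) / real (gcd_vec q)) ^ CARD('m))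
          * emeasure lebesgue (B (max_norm q)))"

text \<open>
  The sequence \<open>B\<close> only matters at indices \<open>\<ge> 1\<close>, hence \<open>q \<noteq> 0\<close> below. Nothing is lost: for
  \<open>q = 0\<close> the coprimality condition would force every \<open>p $ i\<close> to be \<open>\<plusminus>1\<close>, so only finitely
  many pairs are left out.
\<close>

definition solutions ::
  "(nat \<Rightarrow> (real ^ 'm) set) \<Rightarrow> real ^ 'm ^ 'n \<Rightarrow> ((int ^ 'm) \<times> (int ^ 'n)) set" where
  "solutions B x =
     {(p, q). q \<noteq> 0
        \<and> (\<forall>i. Gcd (insert (p $ i) (range (\<lambda>j. q $ j))) = 1)
        \<and> real_vec q v* x - real_vec p \<in> B (max_norm q)}"

end

theory Submission
  imports Defs "HOL-Probability.Probability"
begin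

text \<open>
  For \<open>n > 2\<close> a positive proportion of the integer vectors of maximum norm \<open>k\<close> is primitive, because
  \<open>(\<Sum>d\<ge>2. d powr (1 - n)) \<le> 3/4\<close>. Hence the given series converges if and only if
  \<open>\<Sum>k. k ^ (n - 1) * |B k|\<close> does, and the weights and the coprimality condition play no further role.

  For \<open>q \<noteq> 0\<close> the point \<open>q x\<close> is uniformly distributed modulo \<open>1\<close>, so the expected number of \<open>p\<close>
  with \<open>q x - p \<in> B |q|\<close> is \<open>|B |q||\<close>, which gives the convergence part. For the divergence part
  only primitive \<open>q\<close> with positive entries are used. Two distinct such \<open>q\<close>, \<open>r\<close> are linearly
  independent, so \<open>q x\<close> and \<open>r x\<close> are independent modulo \<open>1\<close>. After shrinking the balls to radius at
  most \<open>1/4\<close>, which makes the integer translates disjoint and preserves divergence, the events are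
  pairwise independent with divergent sum of probabilities, and Chebyshev's inequality yields full measure.
\<close>

section \<open>Lattice-periodic functions\<close>

text \<open>Stated over \<open>Basis\<close> so that one theory serves both the vectors
  \<open>real ^ 'm\<close>, where \<open>q x\<close> lives, and the matrices
  \<open>real ^ 'm ^ 'n\<close>, where \<open>x\<close> lives.\<close>

definition int_lattice :: "'a::euclidean_space set" where
  "int_lattice = {z. \<forall>b\<in>Basis. z \<bullet> b \<in> \<int>}"

definition unit_cell :: "'a::euclidean_space set" where
  "unit_cell = {x. \<forall>b\<in>Basis. 0 \<le> x \<bullet> b \<and> x \<bullet> b < 1}"

text \<open>This stands for Haar probability measure on the torus. As a density on the whole space
  it keeps the Borel sets of \<open>UNIV\<close>, so shifts and linear maps need no restriction of
  domain.\<close>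

definition cell_measure :: "'a::euclidean_space measure" where
  "cell_measure = density lborel (indicator unit_cell)"

lemma int_lattice_uminus: "z \<in> int_lattice \<Longrightarrow> - z \<in> int_lattice"
  by (simp add: int_lattice_def)

lemma countable_int_lattice: "countable (int_lattice :: 'a::euclidean_space set)"
proof -
  let ?f = "\<lambda>z::'a. \<lambda>b\<in>Basis. z \<bullet> b"
  have "inj_on ?f int_lattice"
    by (rule inj_onI, rule euclidean_eqI) (metis restrict_apply')
  moreover have "?f ` int_lattice \<subseteq> Pi\<^sub>E Basis (\<lambda>_. \<int>)"
    by (auto simp: int_lattice_def)
  moreover have "countable (\<int> :: real set)"
    by (simp add: Ints_def)
  ultimately show ?thesis
    by (metis countable_PiE countable_image_inj_on countable_subset finite_Basis)
qed

lemma unit_cell_measurable [measurable]: "unit_cell \<in> sets borel"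
  unfolding unit_cell_def by measurable

lemma emeasure_unit_cell: "emeasure lborel (unit_cell :: 'a::euclidean_space set) = 1"
proof (rule antisym)
  have "unit_cell \<subseteq> cbox 0 (One::'a)"
    by (auto simp: unit_cell_def cbox_def intro: less_imp_le)
  from emeasure_mono[OF this, of lborel] show "emeasure lborel (unit_cell::'a set) \<le> 1"
    by (simp add: emeasure_lborel_cbox_eq)
  have "box 0 One \<subseteq> (unit_cell::'a set)"
    by (auto simp: unit_cell_def box_def intro: less_imp_le)
  from emeasure_mono[OF this, of lborel] show "1 \<le> emeasure lborel (unit_cell::'a set)"
    by (simp add: emeasure_lborel_box_eq)
qed

lemma sets_cell_measure [simp, measurable_cong]: "sets cell_measure = sets borel"
  by (simp add: cell_measure_def)

lemma space_cell_measure [simp]: "space cell_measure = UNIV"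
  by (simp add: cell_measure_def)

lemma nn_integral_cell_measure:
  assumes [measurable]: "f \<in> borel_measurable borel"
  shows "(\<integral>\<^sup>+x. f x \<partial>cell_measure) = (\<integral>\<^sup>+x. indicator unit_cell x * f x \<partial>lborel)"
  by (simp add: cell_measure_def nn_integral_density)

lemma prob_space_cell_measure: "prob_space (cell_measure :: 'a::euclidean_space measure)"
  by (rule prob_spaceI) (simp add: cell_measure_def emeasure_density emeasure_unit_cell)

lemma unit_cell_translate_unique:
  fixes x :: "'a::euclidean_space"
  shows "\<exists>!z. z \<in> int_lattice \<and> x + z \<in> unit_cell"
proof (rule ex_ex1I)
  let ?z = "\<Sum>b\<in>Basis. (- of_int \<lfloor>x \<bullet> b\<rfloor>) *\<^sub>R b"
  have z: "?z \<bullet> b = - of_int \<lfloor>x \<bullet> b\<rfloor>" if "b \<in> Basis" for b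
    using that by (rule inner_sum_left_Basis)
  have "?z \<in> int_lattice"
    unfolding int_lattice_def mem_Collect_eq by (intro ballI, subst z) auto
  moreover have "x + ?z \<in> unit_cell"
    unfolding unit_cell_def mem_Collect_eq inner_add_left by (intro ballI, subst (1 2) z) (auto, linarith)
  ultimately show "\<exists>z. z \<in> int_lattice \<and> x + z \<in> unit_cell" by blast
next
  fix z w
  assume *: "z \<in> int_lattice \<and> x + z \<in> unit_cell" "w \<in> int_lattice \<and> x + w \<in> unit_cell"
  show "z = w"
  proof (rule euclidean_eqI)
    fix b :: 'a assume b: "b \<in> Basis"
    then have "z \<bullet> b \<in> \<int>" "w \<bullet> b \<in> \<int>"
      using * by (auto simp: int_lattice_def)
    then obtain i j where ij: "z \<bullet> b = of_int i" "w \<bullet> b = of_int j"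
      by (metis Ints_cases)
    have "0 \<le> x \<bullet> b + of_int i" "x \<bullet> b + of_int i < 1"
      "0 \<le> x \<bullet> b + of_int j" "x \<bullet> b + of_int j < 1"
      using * b ij by (auto simp: unit_cell_def inner_add_left)
    then have "i = j" by linarith
    then show "z \<bullet> b = w \<bullet> b" using ij by simp
  qed
qed

lemma nn_integral_count_space_indicator_unique:
  assumes "\<exists>!z. z \<in> A \<and> P z"
  shows "(\<integral>\<^sup>+z. indicator {z. P z} z \<partial>count_space A) = 1"
proof -
  obtain z where z: "{z \<in> A. P z} = {z}"
    using assms by (auto simp: Ex1_def)
  have "(\<integral>\<^sup>+z. indicator {z. P z} z \<partial>count_space A) = (\<integral>\<^sup>+z. indicator {z \<in> A. P z} z \<partial>count_space A)"
    by (intro nn_integral_cong) (auto simp: indicator_def)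
  also have "\<dots> = emeasure (count_space A) {z \<in> A. P z}"
    by (intro nn_integral_indicator) auto
  also have "\<dots> = 1"
    using z by (subst emeasure_count_space) auto
  finally show ?thesis .
qed

lemma borel_measurable_nn_integral_count_space:
  fixes f :: "'i \<Rightarrow> 'a \<Rightarrow> ennreal"
  assumes "countable I" and "\<And>i. i \<in> I \<Longrightarrow> f i \<in> borel_measurable M"
  shows "(\<lambda>x. \<integral>\<^sup>+i. f i x \<partial>count_space I) \<in> borel_measurable M"
proof -
  interpret sigma_finite_measure "count_space I"
    using assms(1) by (rule sigma_finite_measure_count_space_countable)
  have "(\<lambda>(x, i). f i x) \<in> borel_measurable (M \<Otimes>\<^sub>M count_space I)"
    unfolding split_beta
    by (rule measurable_compose_countable'[where f = "\<lambda>i p. f i (fst p)" and g = snd and I = I])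
      (use assms in auto)
  then show ?thesis
    by (rule borel_measurable_nn_integral)
qed

lemma nn_integral_lborel_shift:
  fixes f :: "'a::euclidean_space \<Rightarrow> ennreal"
  assumes [measurable]: "f \<in> borel_measurable borel"
  shows "(\<integral>\<^sup>+x. f (x + t) \<partial>lborel) = (\<integral>\<^sup>+x. f x \<partial>lborel)"
proof -
  have "(\<integral>\<^sup>+x. f x \<partial>lborel) = (\<integral>\<^sup>+x. f x \<partial>distr lborel borel ((+) t))"
    by (simp add: lborel_distr_plus)
  also have "\<dots> = (\<integral>\<^sup>+x. f (t + x) \<partial>lborel)"
    by (rule nn_integral_distr) auto
  finally show ?thesis by (simp add: add.commute)
qed

text \<open>The integer translates of the unit cell tile the space, so 1 is the sum over
  \<open>z\<close> of \<open>indicator unit_cell (x + z)\<close>. Inserting this sum, exchanging it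
  with the integral and shifting each term by \<open>z\<close> folds everything back into one
  cell.\<close>

lemma nn_integral_lborel_unfold:
  fixes f :: "'a::euclidean_space \<Rightarrow> ennreal"
  assumes [measurable]: "f \<in> borel_measurable borel"
  shows "(\<integral>\<^sup>+x. f x \<partial>lborel) = (\<integral>\<^sup>+x. (\<integral>\<^sup>+z. f (x - z) \<partial>count_space int_lattice) \<partial>cell_measure)"
proof -
  have "(\<integral>\<^sup>+x. f x \<partial>lborel) =
      (\<integral>\<^sup>+x. (\<integral>\<^sup>+z. indicator unit_cell (x + z) * f x \<partial>count_space int_lattice) \<partial>lborel)"
  proof (intro nn_integral_cong)
    fix x :: 'a
    have "(\<integral>\<^sup>+z. indicator unit_cell (x + z) * f x \<partial>count_space int_lattice) =
        (\<integral>\<^sup>+z. indicator {z. x + z \<in> unit_cell} z \<partial>count_space int_lattice) * f x"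
      by (subst nn_integral_multc[symmetric]) (auto intro!: nn_integral_cong simp: indicator_def)
    then show "f x = (\<integral>\<^sup>+z. indicator unit_cell (x + z) * f x \<partial>count_space int_lattice)"
      by (simp add: nn_integral_count_space_indicator_unique[OF unit_cell_translate_unique])
  qed
  also have "\<dots> = (\<integral>\<^sup>+z. (\<integral>\<^sup>+x. indicator unit_cell (x + z) * f x \<partial>lborel) \<partial>count_space int_lattice)"
    by (rule nn_integral_count_space_nn_integral[OF countable_int_lattice]) measurable
  also have "\<dots> = (\<integral>\<^sup>+z. (\<integral>\<^sup>+x. indicator unit_cell x * f (x - z) \<partial>lborel) \<partial>count_space int_lattice)"
  proof (rule nn_integral_cong)
    fix z :: 'a
    show "(\<integral>\<^sup>+x. indicator unit_cell (x + z) * f x \<partial>lborel) =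
        (\<integral>\<^sup>+x. indicator unit_cell x * f (x - z) \<partial>lborel)"
      using nn_integral_lborel_shift[of "\<lambda>x. indicator unit_cell x * f (x - z)" z] by simp
  qed
  also have "\<dots> = (\<integral>\<^sup>+z. (\<integral>\<^sup>+x. f (x - z) \<partial>cell_measure) \<partial>count_space int_lattice)"
    by (simp add: nn_integral_cell_measure)
  also have "\<dots> = (\<integral>\<^sup>+x. (\<integral>\<^sup>+z. f (x - z) \<partial>count_space int_lattice) \<partial>cell_measure)"
    by (rule nn_integral_count_space_nn_integral[OF countable_int_lattice, symmetric]) measurable
  finally show ?thesis .
qed

definition lattice_periodic :: "('a::euclidean_space \<Rightarrow> 'b) \<Rightarrow> bool" where
  "lattice_periodic f \<longleftrightarrow> (\<forall>x. \<forall>z\<in>int_lattice. f (x + z) = f x)"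

lemma lattice_periodic_add: "lattice_periodic f \<Longrightarrow> z \<in> int_lattice \<Longrightarrow> f (x + z) = f x"
  by (simp add: lattice_periodic_def)

lemma lattice_periodic_diff: "lattice_periodic f \<Longrightarrow> z \<in> int_lattice \<Longrightarrow> f (x - z) = f x"
  using lattice_periodic_add[of f "- z" x] by (simp add: int_lattice_uminus)

text \<open>The cell moved by \<open>t\<close> is another fundamental domain. Unfolding the integral
  over it meets each lattice orbit exactly once, and \<open>f\<close> is constant on orbits.\<close>

lemma nn_integral_cell_measure_shift:
  fixes f :: "'a::euclidean_space \<Rightarrow> ennreal"
  assumes [measurable]: "f \<in> borel_measurable borel" and per: "lattice_periodic f"
  shows "(\<integral>\<^sup>+x. f (x + t) \<partial>cell_measure) = (\<integral>\<^sup>+x. f x \<partial>cell_measure)"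
proof -
  have "(\<integral>\<^sup>+x. f (x + t) \<partial>cell_measure) = (\<integral>\<^sup>+x. indicator unit_cell x * f (x + t) \<partial>lborel)"
    by (simp add: nn_integral_cell_measure)
  also have "\<dots> = (\<integral>\<^sup>+x. indicator unit_cell (x - t) * f x \<partial>lborel)"
    using nn_integral_lborel_shift[of "\<lambda>x. indicator unit_cell (x - t) * f x" t] by simp
  also have "\<dots> = (\<integral>\<^sup>+x. (\<integral>\<^sup>+z. indicator unit_cell (x - z - t) * f (x - z)
      \<partial>count_space int_lattice) \<partial>cell_measure)"
    by (rule nn_integral_lborel_unfold) measurable
  also have "\<dots> = (\<integral>\<^sup>+x. f x \<partial>cell_measure)"
  proof (intro nn_integral_cong)
    fix x :: 'a
    have "\<exists>!z. z \<in> int_lattice \<and> x - z - t \<in> unit_cell"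
      using unit_cell_translate_unique[of "x - t"]
      by (smt (verit, ccfv_threshold) Ex1_def add.commute add_diff_eq diff_minus_eq_add int_lattice_uminus
          minus_minus uminus_add_conv_diff diff_diff_eq2 diff_diff_eq)
    then have "(\<integral>\<^sup>+z. indicator {z. x - z - t \<in> unit_cell} z \<partial>count_space int_lattice) = 1"
      by (rule nn_integral_count_space_indicator_unique)
    moreover have "(\<integral>\<^sup>+z. indicator unit_cell (x - z - t) * f (x - z) \<partial>count_space int_lattice) =
        (\<integral>\<^sup>+z. indicator {z. x - z - t \<in> unit_cell} z * f x \<partial>count_space int_lattice)"
      by (intro nn_integral_cong) (auto simp: lattice_periodic_diff[OF per] indicator_def)
    ultimately show "(\<integral>\<^sup>+z. indicator unit_cell (x - z - t) * f (x - z) \<partial>count_space int_lattice) = f x"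
      by (simp add: nn_integral_multc)
  qed
  finally show ?thesis .
qed

text \<open>By periodicity, all integer translates of a point satisfying \<open>P\<close> satisfy
  \<open>P\<close> as well, so the unfolded indicator of the exceptional set vanishes almost
  everywhere on the cell.\<close>

lemma AE_lborel_if_AE_cell_measure:
  fixes P :: "'a::euclidean_space \<Rightarrow> bool"
  assumes [measurable]: "Measurable.pred borel P" and per: "lattice_periodic P"
    and AE: "AE x in cell_measure. P x"
  shows "AE x in lborel. P x"
proof -
  have "(\<integral>\<^sup>+x. indicator {x. \<not> P x} x \<partial>lborel) =
      (\<integral>\<^sup>+x. (\<integral>\<^sup>+z. indicator {x. \<not> P x} (x - z) \<partial>count_space int_lattice) \<partial>cell_measure)"
    by (rule nn_integral_lborel_unfold) measurable
  also have "\<dots> = (\<integral>\<^sup>+x. 0 \<partial>(cell_measure :: 'a measure))"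
  proof (rule nn_integral_cong_AE, use AE in eventually_elim)
    fix x assume "P x"
    then have "(\<integral>\<^sup>+z. indicator {x. \<not> P x} (x - z) \<partial>count_space int_lattice) =
        (\<integral>\<^sup>+z. 0 \<partial>(count_space int_lattice :: 'a measure))"
      by (intro nn_integral_cong) (auto simp: lattice_periodic_diff[OF per])
    then show "(\<integral>\<^sup>+z. indicator {x. \<not> P x} (x - z) \<partial>count_space int_lattice) = 0"
      by simp
  qed
  finally have "emeasure lborel {x. \<not> P x} = 0"
    by simp
  then show ?thesis
    by (intro AE_I[of _ _ "{x. \<not> P x}"]) auto
qed

text \<open>
  Shifting \<open>x\<close> by \<open>t\<close> turns \<open>g (Q x)\<close> into \<open>g (Q x + u)\<close> without changing the integral;
  averaging over \<open>u\<close> then decouples \<open>g\<close> from \<open>h\<close>.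
\<close>

lemma nn_integral_cell_measure_average:
  fixes Q :: "'a::euclidean_space \<Rightarrow> 'b::euclidean_space"
  assumes "linear Q" and [measurable]: "g \<in> borel_measurable borel" "h \<in> borel_measurable borel"
    and g: "lattice_periodic g" and gh: "lattice_periodic (\<lambda>x. g (Q x) * h x)"
    and t: "\<And>u. \<exists>t. Q t = u \<and> (\<forall>x. h (x + t) = h x)"
  shows "(\<integral>\<^sup>+x. g (Q x) * h x \<partial>cell_measure) =
    (\<integral>\<^sup>+y. g y \<partial>cell_measure) * (\<integral>\<^sup>+x. h x \<partial>cell_measure :: ennreal)"
proof -
  interpret A: prob_space "cell_measure :: 'a measure" by (rule prob_space_cell_measure)
  interpret B: prob_space "cell_measure :: 'b measure" by (rule prob_space_cell_measure)
  interpret pair_sigma_finite "cell_measure :: 'a measure" "cell_measure :: 'b measure" ..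
  interpret Q: bounded_linear Q using \<open>linear Q\<close> by (rule linear_conv_bounded_linear[THEN iffD1])
  have [measurable]: "Q \<in> borel_measurable borel"
    by (intro borel_measurable_continuous_onI Q.continuous_on continuous_on_id)
  have shift: "(\<integral>\<^sup>+x. g (Q x) * h x \<partial>cell_measure) = (\<integral>\<^sup>+x. g (Q x + u) * h x \<partial>cell_measure)" for u
  proof -
    obtain t where t: "Q t = u" "\<And>x. h (x + t) = h x" using t by blast
    show ?thesis
      using nn_integral_cell_measure_shift[OF _ gh, of t] t by (simp add: Q.add)
  qed
  have "(\<integral>\<^sup>+x. g (Q x) * h x \<partial>cell_measure) =
      (\<integral>\<^sup>+u. (\<integral>\<^sup>+x. g (Q x + u) * h x \<partial>cell_measure) \<partial>(cell_measure :: 'b measure))"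
    by (subst shift[symmetric]) (simp add: B.emeasure_space_1[simplified])
  also have "\<dots> = (\<integral>\<^sup>+x. (\<integral>\<^sup>+u. g (Q x + u) * h x \<partial>cell_measure) \<partial>cell_measure)"
    by (rule Fubini') measurable
  also have "\<dots> = (\<integral>\<^sup>+x. (\<integral>\<^sup>+u. g u \<partial>cell_measure) * h x \<partial>cell_measure)"
  proof (intro nn_integral_cong)
    fix x
    show "(\<integral>\<^sup>+u. g (Q x + u) * h x \<partial>cell_measure) = (\<integral>\<^sup>+u. g u \<partial>cell_measure) * h x"
      using nn_integral_cell_measure_shift[OF _ g, of "Q x"]
      by (simp add: nn_integral_multc add.commute)
  qed
  finally show ?thesis
    by (simp add: nn_integral_cmult)
qed

section \<open>Pairwise independent events\<close>

text \<open>Second Borel-Cantelli lemma under pairwise independence. The number of events that occur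
  among a finite family has variance at most its mean, so it is close to a mean that can be made
  arbitrarily large. Divergence is phrased through finite subfamilies, which avoids enumerating
  \<open>I\<close>.\<close>

lemma (in prob_space) AE_infinite_if_pairwise_indep:
  fixes A :: "'i \<Rightarrow> 'a set"
  assumes A [measurable]: "\<And>i. i \<in> I \<Longrightarrow> A i \<in> events"
    and indep: "\<And>i j. i \<in> I \<Longrightarrow> j \<in> I \<Longrightarrow> i \<noteq> j \<Longrightarrow> prob (A i \<inter> A j) = prob (A i) * prob (A j)"
    and div: "\<And>K::real. \<exists>F. finite F \<and> F \<subseteq> I \<and> (\<Sum>i\<in>F. prob (A i)) \<ge> K"
  shows "AE x in M. infinite {i \<in> I. x \<in> A i}"
proof -
  define S where "S F x = (\<Sum>i\<in>F. indicator (A i) x :: real)" for F x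
  define \<mu> where "\<mu> F = (\<Sum>i\<in>F. prob (A i))" for F
  have S_meas: "S F \<in> borel_measurable M" if "F \<subseteq> I" for F
    unfolding S_def using that by (intro borel_measurable_sum) auto
  \<comment> \<open>Chebyshev with deviation half the mean: as \<open>2 * K\<close> is at most the
    mean, \<open>S F x \<le> K\<close> forces such a deviation, and a variance of at most the mean
    leaves the factor 4.\<close>
  have bound: "prob {x \<in> space M. S F x \<le> K} \<le> 4 / \<mu> F"
    if F: "finite F" "F \<subseteq> I" and K: "2 * K \<le> \<mu> F" "0 < \<mu> F" for F K
  proof -
    note [measurable] = S_meas[OF F(2)]
    have int: "integrable M (\<lambda>x. indicator (A i) x * indicator (A j) x :: real)"
      if "i \<in> F" "j \<in> F" for i j
    proof -
      have "A i \<inter> A j \<in> events" using that F A by (auto intro!: sets.Int)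
      then have "integrable M (indicator (A i \<inter> A j) :: _ \<Rightarrow> real)"
        by (simp add: less_top[symmetric])
      then show ?thesis by (simp add: indicator_inter_arith[symmetric])
    qed
    have S2: "(S F x)\<^sup>2 = (\<Sum>i\<in>F. \<Sum>j\<in>F. indicator (A i) x * indicator (A j) x)" for x
      by (simp add: S_def power2_eq_square sum_product)
    have int2: "integrable M (\<lambda>x. (S F x)\<^sup>2)"
      unfolding S2 by (intro Bochner_Integration.integrable_sum int)
    have int1: "integrable M (S F)"
      unfolding S_def using F by (intro Bochner_Integration.integrable_sum) (auto simp: less_top[symmetric])
    have E1: "expectation (S F) = \<mu> F"
      unfolding S_def \<mu>_def
      using F by (subst Bochner_Integration.integral_sum) (auto simp: less_top[symmetric] intro!: sum.cong)
    have "expectation (\<lambda>x. (S F x)\<^sup>2) = (\<Sum>i\<in>F. \<Sum>j\<in>F. expectation (\<lambda>x. indicator (A i) x * indicator (A j) x))"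
      unfolding S2 by (simp add: Bochner_Integration.integral_sum int)
    also have "\<dots> = (\<Sum>i\<in>F. \<Sum>j\<in>F. prob (A i \<inter> A j))"
    proof (intro sum.cong refl)
      fix i j assume "i \<in> F" "j \<in> F"
      then have "A i \<inter> A j \<in> events" using F A by (auto intro!: sets.Int)
      then show "expectation (\<lambda>x. indicator (A i) x * indicator (A j) x) = prob (A i \<inter> A j)"
        by (simp add: indicator_inter_arith[symmetric])
    qed
    \<comment> \<open>Off the diagonal independence gives equality. On the diagonal the intersection
      is \<open>A i\<close> itself, which accounts for the extra \<open>prob (A i)\<close>; these
      extra terms add up to the mean.\<close>
    also have "\<dots> \<le> (\<Sum>i\<in>F. \<Sum>j\<in>F. prob (A i) * prob (A j) + (if i = j then prob (A i) else 0))"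
      using F indep by (intro sum_mono) (auto simp: subset_iff)
    also have "\<dots> = (\<mu> F)\<^sup>2 + \<mu> F"
      using F by (simp add: sum.distrib \<mu>_def power2_eq_square sum_product)
    finally have var: "variance (S F) \<le> \<mu> F"
      using variance_eq[OF int1 int2] E1 by simp
    have "prob {x \<in> space M. S F x \<le> K} \<le> prob {x \<in> space M. \<bar>S F x - expectation (S F)\<bar> \<ge> \<mu> F / 2}"
      using K by (intro finite_measure_mono) (auto simp: E1)
    also have "\<dots> \<le> variance (S F) / (\<mu> F / 2)\<^sup>2"
      using K by (intro Chebyshev_inequality int2) auto
    also have "\<dots> \<le> \<mu> F / (\<mu> F / 2)\<^sup>2"
      using var by (intro divide_right_mono) auto
    also have "\<dots> = 4 / \<mu> F"
      using K by (simp add: power2_eq_square field_simps)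
    finally show ?thesis .
  qed
  have "\<exists>F. \<forall>j::nat. finite (F j) \<and> F j \<subseteq> I \<and> \<mu> (F j) \<ge> real j"
    unfolding \<mu>_def by (intro choice allI div)
  then obtain F where F: "\<And>j. finite (F j)" "\<And>j. F j \<subseteq> I" "\<And>j. \<mu> (F j) \<ge> real j"
    by blast
  have "AE x in M. \<exists>j. S (F j) x > real k" for k :: nat
  proof -
    define D where "D = {x \<in> space M. \<forall>j. S (F j) x \<le> real k}"
    note [measurable] = S_meas[OF F(2)]
    have [measurable]: "D \<in> events" unfolding D_def by measurable
    have "prob D \<le> 0 + e" if e: "e > 0" for e
    proof -
      \<comment> \<open>The summand \<open>4 / e\<close> brings the Chebyshev bound below
        \<open>e\<close>, and \<open>2 * real k\<close> makes that bound applicable with threshold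
        \<open>k\<close>.\<close>
      obtain j :: nat where j: "real j \<ge> 4 / e + 2 * real k + 1" using real_arch_simple by blast
      have \<mu>: "\<mu> (F j) \<ge> 4 / e" "\<mu> (F j) \<ge> 2 * real k" "\<mu> (F j) > 0"
        using j F(3)[of j] e by (auto intro: order_trans[rotated] simp: add_increasing add_increasing2)
          (smt (verit) divide_pos_pos of_nat_0_le_iff)+
      have "prob D \<le> prob {x \<in> space M. S (F j) x \<le> real k}"
        by (intro finite_measure_mono) (auto simp: D_def)
      also have "\<dots> \<le> 4 / \<mu> (F j)"
        using \<mu> by (intro bound F) auto
      also have "\<dots> \<le> e" using \<mu> e by (simp add: field_simps)
      finally show ?thesis by simp
    qed
    then have "prob D \<le> 0" by (rule field_le_epsilon)
    then have "emeasure M D = 0" by (simp add: emeasure_eq_measure measure_le_0_iff)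
    then show ?thesis
      by (intro AE_I[of _ _ D]) (auto simp: D_def not_less)
  qed
  then have "AE x in M. \<forall>k::nat. \<exists>j. S (F j) x > real k"
    by (simp add: AE_all_countable)
  then show ?thesis
  proof eventually_elim
    fix x assume x: "\<forall>k::nat. \<exists>j. S (F j) x > real k"
    show "infinite {i \<in> I. x \<in> A i}"
    proof
      assume fin: "finite {i \<in> I. x \<in> A i}"
      obtain j where "S (F j) x > real (card {i \<in> I. x \<in> A i})" using x by blast
      moreover have "S (F j) x = real (card {i \<in> F j. x \<in> A i})"
        using F(1)[of j] by (simp add: S_def indicator_def Int_def flip: sum.inter_filter)
      moreover have "card {i \<in> F j. x \<in> A i} \<le> card {i \<in> I. x \<in> A i}"
        using F(2)[of j] by (intro card_mono fin) auto
      ultimately show False by simp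
    qed
  qed
qed

section \<open>Counting primitive vectors\<close>

lemma card_vec_box:
  fixes S :: "'n::finite \<Rightarrow> 'a set"
  assumes "\<And>j. finite (S j)"
  shows "finite {q :: 'a ^ 'n. \<forall>j. q $ j \<in> S j}"
    and "card {q :: 'a ^ 'n. \<forall>j. q $ j \<in> S j} = (\<Prod>j\<in>UNIV. card (S j))"
proof -
  have *: "bij_betw vec_nth {q :: 'a ^ 'n. \<forall>j. q $ j \<in> S j} (Pi\<^sub>E UNIV S)"
    by (rule bij_betw_byWitness[where f' = vec_lambda]) (auto simp: PiE_def Pi_def)
  show "finite {q :: 'a ^ 'n. \<forall>j. q $ j \<in> S j}"
    using bij_betw_finite[OF *] assms by (simp add: finite_PiE)
  show "card {q :: 'a ^ 'n. \<forall>j. q $ j \<in> S j} = (\<Prod>j\<in>UNIV. card (S j))"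
    using bij_betw_same_card[OF *] by (simp add: card_PiE)
qed

lemma prod_card_if_eq:
  fixes i :: "'n::finite"
  shows "(\<Prod>j\<in>UNIV. card (if j = i then S else T)) = card S * card T ^ (CARD('n) - 1)"
  by (simp add: prod.remove[of UNIV i])

lemma abs_le_max_norm: "\<bar>q $ i\<bar> \<le> int (max_norm (q :: int ^ 'n::finite))"
proof -
  have "\<bar>q $ i\<bar> \<le> Max (range (\<lambda>i. \<bar>q $ i\<bar>))" by (intro Max_ge) auto
  then show ?thesis unfolding max_norm_def by linarith
qed

lemma max_norm_attained: "\<exists>i. \<bar>q $ i\<bar> = int (max_norm (q :: int ^ 'n::finite))"
proof -
  have "Max (range (\<lambda>i. \<bar>q $ i\<bar>)) \<in> range (\<lambda>i. \<bar>q $ i\<bar>)" by (intro Max_in) auto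
  then show ?thesis by (force simp: max_norm_def)
qed

lemma max_norm_eq_0_iff: "max_norm (q :: int ^ 'n::finite) = 0 \<longleftrightarrow> q = 0"
proof
  assume "max_norm q = 0"
  then show "q = 0" using abs_le_max_norm[of q] by (auto simp: vec_eq_iff)
next
  assume "q = 0"
  then show "max_norm q = 0" using max_norm_attained[of q] by auto
qed

text \<open>Some entry equals \<open>k\<close> or \<open>- k\<close> and the others lie between
  \<open>- k\<close> and \<open>k\<close>. This gives at most
  \<open>2 * (2 * k + 1) ^ (CARD('n) - 1)\<close> vectors for each position of that entry, and
  \<open>2 * k + 1 \<le> 3 * k\<close> since \<open>k \<ge> 1\<close>.\<close>

lemma card_max_norm_sphere:
  assumes "k \<ge> 1"
  shows "finite {q :: int ^ 'n::finite. max_norm q = k}"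
    and "card {q :: int ^ 'n::finite. max_norm q = k} \<le> 2 * CARD('n) * 3 ^ (CARD('n) - 1) * k ^ (CARD('n) - 1)"
proof -
  define S where "S i = {q :: int ^ 'n. \<forall>j. q $ j \<in> (if j = i then {int k, - int k} else {- int k..int k})}" for i
  have fin: "finite (S i)" for i
    unfolding S_def by (rule card_vec_box) auto
  have "card (S i) = 2 * (2 * k + 1) ^ (CARD('n) - 1)" for i
  proof -
    have "card (S i) = card {int k, - int k} * card {- int k..int k} ^ (CARD('n) - 1)"
      unfolding S_def by (subst card_vec_box) (auto simp: prod_card_if_eq)
    moreover have "card {- int k..int k} = 2 * k + 1" by simp
    moreover have "card {int k, - int k} = 2" using assms by simp
    ultimately show ?thesis by (simp only:)
  qed
  also have "2 * (2 * k + 1) ^ (CARD('n) - 1) \<le> 2 * (3 * k) ^ (CARD('n) - 1)"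
    using assms by (intro mult_left_mono power_mono) auto
  finally have card: "card (S i) \<le> 2 * (3 * k) ^ (CARD('n) - 1)" for i .
  have sub: "{q. max_norm q = k} \<subseteq> (\<Union>i. S i)"
  proof
    fix q :: "int ^ 'n" assume "q \<in> {q. max_norm q = k}"
    then have k: "max_norm q = k" by simp
    obtain i where i: "\<bar>q $ i\<bar> = int k" using max_norm_attained[of q] k by auto
    have "- int k \<le> q $ j \<and> q $ j \<le> int k" for j
      using abs_le_max_norm[of q j] k by auto
    then have "q \<in> S i" using i by (auto simp: S_def)
    then show "q \<in> (\<Union>i. S i)" by blast
  qed
  show "finite {q :: int ^ 'n. max_norm q = k}"
    using fin by (intro finite_subset[OF sub]) auto
  have "card {q :: int ^ 'n. max_norm q = k} \<le> card (\<Union>i. S i)"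
    using fin by (intro card_mono sub) auto
  also have "\<dots> \<le> (\<Sum>i\<in>UNIV. card (S i))" by (rule card_UN_le) auto
  also have "\<dots> \<le> (\<Sum>i\<in>(UNIV::'n set). 2 * (3 * k) ^ (CARD('n) - 1))" by (intro sum_mono card)
  finally show "card {q :: int ^ 'n. max_norm q = k} \<le> 2 * CARD('n) * 3 ^ (CARD('n) - 1) * k ^ (CARD('n) - 1)"
    by (simp add: power_mult_distrib algebra_simps)
qed

text \<open>
  All entries are positive, so that no two distinct members, even for different \<open>k\<close>, are parallel.
\<close>

definition primitive_sphere :: "'n::finite \<Rightarrow> nat \<Rightarrow> (int ^ 'n) set" where
  "primitive_sphere i k = {q. q $ i = int k \<and> (\<forall>j. q $ j \<in> {1..int k}) \<and> gcd_vec q = 1}"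

lemma primitive_sphere_max_norm:
  assumes "q \<in> primitive_sphere i k"
  shows "max_norm q = k"
proof -
  have q: "q $ i = int k" "\<And>j. 1 \<le> q $ j \<and> q $ j \<le> int k"
    using assms by (auto simp: primitive_sphere_def)
  obtain j where "\<bar>q $ j\<bar> = int (max_norm q)" using max_norm_attained by blast
  then show ?thesis using q(2)[of j] abs_le_max_norm[of q i] q(1) by linarith
qed

lemma sum_inverse_squares_le: "(\<Sum>d=2..k. 1 / real d ^ 2) \<le> 3 / 4"
proof (cases "k \<ge> 2")
  case True
  \<comment> \<open>The correction \<open>1 / real k\<close> makes the induction telescope. At
    \<open>k = 2\<close> both sides equal 1/4. What matters later is that 3/4 is less than
    1.\<close>
  then have "(\<Sum>d=2..k. 1 / real d ^ 2) \<le> 3 / 4 - 1 / real k"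
  proof (induction k rule: dec_induct)
    case base
    show ?case by simp
  next
    case (step k)
    have "1 / real (Suc k) ^ 2 \<le> 1 / real k - 1 / real (Suc k)"
    proof -
      have "1 / real (Suc k) ^ 2 \<le> 1 / (real k * real (Suc k))"
        using step.hyps by (intro divide_left_mono) (auto simp: power2_eq_square)
      also have "\<dots> = 1 / real k - 1 / real (Suc k)"
        using step.hyps by (simp add: field_simps)
      finally show ?thesis .
    qed
    then show ?case using step by simp
  qed
  also have "\<dots> \<le> 3 / 4" by simp
  finally show ?thesis .
qed auto

text \<open>A sieve on the face \<open>Q\<close>, which has \<open>k ^ (CARD('n) - 1)\<close>
  points. A non-primitive point has all entries divisible by some \<open>d\<close> with
  \<open>2 \<le> d \<le> k\<close>, and at most \<open>(k div d) ^ (CARD('n) - 1)\<close> points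
  have this property for a given \<open>d\<close>. As the exponent is at least 2, which is where
  \<open>CARD('n) > 2\<close> enters, at most three quarters of the face are lost.\<close>

lemma card_primitive_sphere:
  fixes i :: "'n::finite"
  assumes n: "CARD('n) > 2" and k: "k \<ge> 1"
  shows "finite (primitive_sphere i k)"
    and "real k ^ (CARD('n) - 1) \<le> 4 * real (card (primitive_sphere i k))"
proof -
  define n where "n = CARD('n) - 1"
  have n2: "n \<ge> 2" using n by (simp add: n_def)
  define Q where "Q = {q :: int ^ 'n. \<forall>j. q $ j \<in> (if j = i then {int k} else {1..int k})}"
  \<comment> \<open>This covers the points of \<open>Q\<close> with gcd \<open>d\<close>: entry
    \<open>i\<close> stays fixed at \<open>k\<close> and every other entry runs through the
    multiples of \<open>d\<close> up to \<open>k\<close>.\<close>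
  define D where "D d = {q :: int ^ 'n. \<forall>j. q $ j \<in> (if j = i then {int k} else (\<lambda>t. int d * t) ` {1..int (k div d)})}" for d :: nat
  have Q: "finite Q" "card Q = k ^ n"
    unfolding Q_def n_def using card_vec_box[of "\<lambda>j. if j = i then {int k} else {1..int k}"]
    by (simp_all add: prod_card_if_eq)
  have D: "finite (D d)" "card (D d) \<le> (k div d) ^ n" for d
  proof -
    let ?S = "\<lambda>j. if j = i then {int k} else (\<lambda>t. int d * t) ` {1..int (k div d)}"
    show "finite (D d)"
      unfolding D_def by (rule card_vec_box) simp
    have "card (D d) = card ((\<lambda>t. int d * t) ` {1..int (k div d)}) ^ n"
      unfolding D_def n_def using card_vec_box(2)[of ?S] by (simp add: prod_card_if_eq)
    also have "\<dots> \<le> (k div d) ^ n"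
      using card_image_le[of "{1..int (k div d)}" "\<lambda>t. int d * t"] by (intro power_mono) simp_all
    finally show "card (D d) \<le> (k div d) ^ n" .
  qed
  have PQ: "primitive_sphere i k \<subseteq> Q"
    by (auto simp: primitive_sphere_def Q_def)
  then show fin: "finite (primitive_sphere i k)"
    using Q(1) finite_subset by blast
  have sub: "Q \<subseteq> primitive_sphere i k \<union> (\<Union>d\<in>{2..k}. D d)"
  proof
    fix q assume "q \<in> Q"
    then have q: "q $ i = int k" "\<And>j. q $ j \<in> {1..int k}"
    proof -
      have *: "q $ j \<in> (if j = i then {int k} else {1..int k})" for j
        using \<open>q \<in> Q\<close> by (simp add: Q_def)
      show "q $ i = int k" using *[of i] by simp
      show "q $ j \<in> {1..int k}" for j using *[of j] k by (cases "j = i") auto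
    qed
    define d where "d = gcd_vec q"
    have d: "int d = Gcd (range (\<lambda>i. q $ i))"
      by (simp add: d_def gcd_vec_def)
    have dvd: "int d dvd q $ j" for j
      unfolding d by (intro Gcd_dvd) auto
    have "int d dvd int k" using dvd[of i] q(1) by simp
    then have "d dvd k" by simp
    then have dk: "d \<le> k" "d \<noteq> 0" using k by (auto intro: dvd_imp_le)
    show "q \<in> primitive_sphere i k \<union> (\<Union>d\<in>{2..k}. D d)"
    proof (cases "d = 1")
      case True
      then show ?thesis using q by (simp add: primitive_sphere_def d_def)
    next
      case False
      have "q $ j \<in> (\<lambda>t. int d * t) ` {1..int (k div d)}" for j
      proof -
        obtain t where t: "q $ j = int d * t" using dvd[of j] by blast
        have dt: "1 \<le> int d * t" "int d * t \<le> int k" using q(2)[of j] t by auto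
        have "0 < int d * t" using dt(1) by linarith
        then have "1 \<le> t" using dk by (simp add: zero_less_mult_iff)
        moreover have "t \<le> int k div int d"
          using zdiv_mono1[OF dt(2), of "int d"] dk by simp
        ultimately show ?thesis using t by (auto simp: zdiv_int)
      qed
      then have "q \<in> D d" using q(1) by (auto simp: D_def)
      moreover have "d \<in> {2..k}" using dk False by auto
      ultimately show ?thesis by blast
    qed
  qed
  have "k ^ n \<le> card (primitive_sphere i k \<union> (\<Union>d\<in>{2..k}. D d))"
    unfolding Q(2)[symmetric] using fin D(1) by (intro card_mono sub) auto
  also have "\<dots> \<le> card (primitive_sphere i k) + card (\<Union>d\<in>{2..k}. D d)"
    by (rule card_Un_le)
  also have "card (\<Union>d\<in>{2..k}. D d) \<le> (\<Sum>d=2..k. card (D d))"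
    by (rule card_UN_le) auto
  also have "\<dots> \<le> (\<Sum>d=2..k. (k div d) ^ n)"
    by (intro sum_mono D)
  finally have "real (k ^ n) \<le> real (card (primitive_sphere i k) + (\<Sum>d=2..k. (k div d) ^ n))"
    by linarith
  also have "\<dots> = real (card (primitive_sphere i k)) + (\<Sum>d=2..k. real (k div d) ^ n)"
    by simp
  also have "(\<Sum>d=2..k. real (k div d) ^ n) \<le> (\<Sum>d=2..k. real k ^ n * (1 / real d ^ 2))"
  proof (intro sum_mono)
    fix d assume d: "d \<in> {2..k}"
    have "real (k div d) ^ n \<le> (real k / real d) ^ n"
      by (intro power_mono of_nat_div_le_of_nat) auto
    also have "\<dots> = real k ^ n * (1 / real d ^ n)"
      by (simp add: power_divide)
    also have "\<dots> \<le> real k ^ n * (1 / real d ^ 2)"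
      using d n2 by (intro mult_left_mono divide_left_mono power_increasing) auto
    finally show "real (k div d) ^ n \<le> real k ^ n * (1 / real d ^ 2)" .
  qed
  also have "\<dots> = real k ^ n * (\<Sum>d=2..k. 1 / real d ^ 2)"
    by (simp add: sum_distrib_left)
  also have "\<dots> \<le> real k ^ n * (3 / 4)"
    by (intro mult_left_mono sum_inverse_squares_le) auto
  finally show "real k ^ (CARD('n) - 1) \<le> 4 * real (card (primitive_sphere i k))"
    by (simp add: n_def)
qed

text \<open>If all these minors vanish, then \<open>k\<close> times \<open>r\<close> equals
  \<open>l\<close> times \<open>q\<close>. Comparing the gcd of the entries on both sides gives
  \<open>k = l\<close>, since both vectors are primitive, and hence \<open>q = r\<close>. The
  nonzero minor later yields independence of \<open>q x\<close> and \<open>r x\<close>.\<close>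

lemma primitive_spheres_minor_nonzero:
  assumes q: "q \<in> primitive_sphere i k" and r: "r \<in> primitive_sphere i l" and "q \<noteq> r"
  shows "\<exists>j. q $ i * r $ j - q $ j * r $ i \<noteq> 0"
proof (rule ccontr)
  assume "\<not> ?thesis"
  then have *: "int k * r $ j = q $ j * int l" for j
    using q r by (auto simp: primitive_sphere_def)
  have gcd: "Gcd (range (\<lambda>j. q $ j)) = 1" "Gcd (range (\<lambda>j. r $ j)) = 1"
    using q r by (auto simp: primitive_sphere_def gcd_vec_def nat_eq_iff)
  have "int k = Gcd ((*) (int k) ` range (\<lambda>j. r $ j))"
    unfolding Gcd_mult gcd by simp
  also have "(*) (int k) ` range (\<lambda>j. r $ j) = (*) (int l) ` range (\<lambda>j. q $ j)"
    using * by (auto simp: image_iff mult.commute)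
  also have "Gcd \<dots> = int l"
    unfolding Gcd_mult gcd by simp
  finally have "k = l" by simp
  moreover have "k \<noteq> 0" using q by (auto simp: primitive_sphere_def dest: spec[of _ i])
  ultimately have "q = r" using * by (auto simp: vec_eq_iff mult.commute)
  then show False using \<open>q \<noteq> r\<close> by simp
qed

section \<open>Series over integer vectors and series over their norms\<close>

text \<open>Passing to counting measure makes Tonelli's theorem available for the given series; the
  infinite sum is the supremum of its finite partial sums.\<close>

lemma infsum_ennreal_le_nn_integral:
  fixes f :: "'a \<Rightarrow> ennreal"
  shows "infsum f A \<le> (\<integral>\<^sup>+x. f x \<partial>count_space A)"
  unfolding nonneg_infsum_complete[of A f, OF zero_le]
proof (rule SUP_least)
  fix F assume F: "F \<in> {F. finite F \<and> F \<subseteq> A}"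
  then have "sum f F = (\<integral>\<^sup>+x. f x * indicator F x \<partial>count_space A)"
    by (subst nn_integral_indicator_finite) (auto intro!: sum.cong)
  also have "\<dots> \<le> (\<integral>\<^sup>+x. f x \<partial>count_space A)"
    by (intro nn_integral_mono) (auto simp: indicator_def)
  finally show "sum f F \<le> (\<integral>\<^sup>+x. f x \<partial>count_space A)" .
qed

lemma sum_ennreal_le_infsum:
  fixes f :: "'a \<Rightarrow> ennreal"
  assumes "finite F" "F \<subseteq> A"
  shows "sum f F \<le> infsum f A"
  unfolding nonneg_infsum_complete[of A f, OF zero_le]
  using assms by (intro SUP_upper) auto

text \<open>Grouping the vectors by norm, the sphere of norm \<open>k\<close> contributes at most a
  constant times \<open>real k ^ (CARD('n) - 1) * a k\<close>.\<close>

lemma nn_integral_max_norm_finite: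
  fixes a :: "nat \<Rightarrow> real"
  assumes a: "\<And>k. 0 \<le> a k" and sum: "summable (\<lambda>k. real k ^ (CARD('n::finite) - 1) * a k)"
  shows "(\<integral>\<^sup>+q. ennreal (a (max_norm q)) \<partial>count_space (UNIV - {0 :: int ^ 'n})) < \<infinity>"
proof -
  define n where "n = CARD('n) - 1"
  define C where "C = 2 * CARD('n) * 3 ^ n"
  let ?I = "UNIV - {0 :: int ^ 'n}"
  have "(\<integral>\<^sup>+q. ennreal (a (max_norm q)) \<partial>count_space ?I) =
      (\<integral>\<^sup>+q. (\<integral>\<^sup>+k. ennreal (a k) * indicator {q. max_norm q = k} q \<partial>count_space UNIV) \<partial>count_space ?I)"
  proof (rule nn_integral_cong)
    fix q :: "int ^ 'n"
    have "(\<integral>\<^sup>+k. ennreal (a k) * indicator {q. max_norm q = k} q \<partial>count_space UNIV) =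
        (\<integral>\<^sup>+k. ennreal (a k) * indicator {max_norm q} k \<partial>count_space UNIV)"
      by (intro nn_integral_cong) (auto simp: indicator_def)
    also have "\<dots> = ennreal (a (max_norm q))"
      by (subst nn_integral_indicator_finite) auto
    finally show "ennreal (a (max_norm q)) =
        (\<integral>\<^sup>+k. ennreal (a k) * indicator {q. max_norm q = k} q \<partial>count_space UNIV)" ..
  qed
  also have "\<dots> = (\<integral>\<^sup>+k. (\<integral>\<^sup>+q. ennreal (a k) * indicator {q. max_norm q = k} q \<partial>count_space ?I) \<partial>count_space UNIV)"
    by (rule nn_integral_count_space_nn_integral) auto
  also have "\<dots> \<le> (\<integral>\<^sup>+k. ennreal (real C * (real k ^ n * a k)) \<partial>count_space UNIV)"
  proof (rule nn_integral_mono)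
    fix k :: nat
    show "(\<integral>\<^sup>+q. ennreal (a k) * indicator {q. max_norm q = k} q \<partial>count_space ?I) \<le>
        ennreal (real C * (real k ^ n * a k))"
    proof (cases "k = 0")
      \<comment> \<open>The only vector of norm 0 is the zero vector, which lies outside the index
        set.\<close>
      case True
      have "(\<integral>\<^sup>+q. ennreal (a k) * indicator {q. max_norm q = k} q \<partial>count_space ?I) =
          (\<integral>\<^sup>+q. 0 \<partial>count_space ?I)"
        by (rule nn_integral_cong) (auto simp: True max_norm_eq_0_iff)
      then show ?thesis by simp
    next
      case False
      let ?S = "{q :: int ^ 'n. max_norm q = k}"
      have fin: "finite ?S" and card: "card ?S \<le> C * k ^ n"
        using card_max_norm_sphere[of k, where 'n = 'n] False by (auto simp: C_def n_def)
      have S: "?S \<subseteq> ?I" using False by (auto simp: max_norm_eq_0_iff[THEN iffD2])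
      have "(\<integral>\<^sup>+q. ennreal (a k) * indicator ?S q \<partial>count_space ?I) =
          ennreal (a k) * emeasure (count_space ?I) ?S"
        using S by (subst nn_integral_cmult_indicator) auto
      also have "\<dots> = ennreal (a k) * ennreal (real (card ?S))"
        using S fin by (simp add: ennreal_of_nat_eq_real_of_nat)
      also have "\<dots> = ennreal (a k * real (card ?S))"
        by (simp add: ennreal_mult a)
      also have "\<dots> \<le> ennreal (a k * real (C * k ^ n))"
        using card a by (intro ennreal_leI mult_left_mono of_nat_mono) auto
      finally show ?thesis by (simp add: algebra_simps)
    qed
  qed
  also have "\<dots> = (\<Sum>k. ennreal (real C * (real k ^ n * a k)))"
    by (rule nn_integral_count_space_nat)
  also have "\<dots> = ennreal (\<Sum>k. real C * (real k ^ n * a k))"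
    using sum a unfolding n_def by (intro suminf_ennreal2 summable_mult) auto
  also have "\<dots> < \<infinity>" by simp
  finally show ?thesis .
qed

text \<open>Primitive spheres of different norm are disjoint and each has at least a quarter of
  \<open>k ^ (CARD('n) - 1)\<close> points. A partial sum of the radial series above
  \<open>4 * K\<close> therefore yields a finite family with sum at least \<open>K\<close>.\<close>

lemma sum_primitive_spheres_unbounded:
  fixes b :: "nat \<Rightarrow> real" and i :: "'n::finite"
  assumes n: "CARD('n) > 2" and b: "\<And>k. 0 \<le> b k"
    and div: "\<not> summable (\<lambda>k. real k ^ (CARD('n) - 1) * b k)"
  shows "\<exists>F. finite F \<and> F \<subseteq> (\<Union>k. primitive_sphere i k) \<and> K \<le> (\<Sum>q\<in>F. b (max_norm q))"
proof -
  have "\<exists>N. 4 * K < (\<Sum>k<N. real k ^ (CARD('n) - 1) * b k)"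
  proof (rule ccontr)
    assume "\<not> ?thesis"
    then have "summable (\<lambda>k. real k ^ (CARD('n) - 1) * b k)"
      using b by (intro summableI_nonneg_bounded[where x = "4 * K"]) (auto simp: not_less)
    then show False using div by simp
  qed
  then obtain N where N: "4 * K < (\<Sum>k<N. real k ^ (CARD('n) - 1) * b k)" by blast
  define F where "F = (\<Union>k\<in>{1..<N}. primitive_sphere i k)"
  have fin: "finite (primitive_sphere i k)" if "k \<ge> 1" for k
    using card_primitive_sphere(1)[OF n that] .
  have "(\<Sum>q\<in>F. b (max_norm q)) = (\<Sum>k=1..<N. \<Sum>q\<in>primitive_sphere i k. b (max_norm q))"
    unfolding F_def using fin by (intro sum.UNION_disjoint) (auto dest!: primitive_sphere_max_norm)
  also have "\<dots> = (\<Sum>k=1..<N. real (card (primitive_sphere i k)) * b k)"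
    by (intro sum.cong refl) (simp add: primitive_sphere_max_norm)
  finally have F: "(\<Sum>q\<in>F. b (max_norm q)) = (\<Sum>k=1..<N. real (card (primitive_sphere i k)) * b k)" .
  \<comment> \<open>The term at \<open>k = 0\<close> vanishes because the exponent is
    positive.\<close>
  have "(\<Sum>k<N. real k ^ (CARD('n) - 1) * b k) = (\<Sum>k=1..<N. real k ^ (CARD('n) - 1) * b k)"
    using n by (intro sum.mono_neutral_right) auto
  also have "\<dots> \<le> (\<Sum>k=1..<N. 4 * real (card (primitive_sphere i k)) * b k)"
    using card_primitive_sphere(2)[OF n] b by (intro sum_mono mult_right_mono) auto
  also have "\<dots> = 4 * (\<Sum>q\<in>F. b (max_norm q))"
    by (simp add: F sum_distrib_left mult.assoc)
  finally have "K \<le> (\<Sum>q\<in>F. b (max_norm q))" using N by simp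
  moreover have "finite F" "F \<subseteq> (\<Union>k. primitive_sphere i k)"
    using fin by (auto simp: F_def)
  ultimately show ?thesis by blast
qed

text \<open>Were the series of \<open>b\<close> summable, its terms would tend to 0, so eventually
  \<open>b k < c\<close>. There \<open>min (a k) c \<le> b k\<close> forces
  \<open>a k \<le> b k\<close>, and comparison makes the series of \<open>a\<close>
  summable.\<close>

lemma not_summable_truncate:
  fixes a b :: "nat \<Rightarrow> real"
  assumes "\<not> summable (\<lambda>k. real k ^ n * a k)" and "0 < c"
    and b: "\<And>k. k \<ge> 1 \<Longrightarrow> min (a k) c \<le> b k" and a: "\<And>k. 0 \<le> a k"
  shows "\<not> summable (\<lambda>k. real k ^ n * b k)"
proof
  assume sum: "summable (\<lambda>k. real k ^ n * b k)"
  then have "(\<lambda>k. real k ^ n * b k) \<longlonglongrightarrow> 0" by (rule summable_LIMSEQ_zero)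
  then have "\<forall>\<^sub>F k in sequentially. real k ^ n * b k < c"
    using \<open>0 < c\<close> by (rule order_tendstoD)
  then have "\<forall>\<^sub>F k in sequentially. norm (real k ^ n * a k) \<le> real k ^ n * b k"
    using eventually_ge_at_top[of 1]
  proof eventually_elim
    fix k :: nat assume k: "real k ^ n * b k < c" "1 \<le> k"
    have "0 \<le> b k" using b[OF k(2)] a[of k] \<open>0 < c\<close> by linarith
    then have "1 * b k \<le> real k ^ n * b k"
      using k(2) by (intro mult_right_mono one_le_power) auto
    then have "a k \<le> b k" using b[OF k(2)] k(1) by linarith
    then show "norm (real k ^ n * a k) \<le> real k ^ n * b k"
      using a[of k] by (simp add: abs_mult mult_left_mono)
  qed
  then have "summable (\<lambda>k. real k ^ n * a k)"
    using sum by (rule summable_comparison_test_ev)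
  then show False using assms(1) by simp
qed

section \<open>Equidistribution modulo one\<close>

text \<open>The periodization of the indicator of \<open>S\<close>: the number of integer points
  \<open>z\<close> with \<open>y - z\<close> in \<open>S\<close>, possibly infinite. By unfolding,
  its mean over the cell is the measure of \<open>S\<close>.\<close>

definition lattice_count :: "'a::euclidean_space set \<Rightarrow> 'a \<Rightarrow> ennreal" where
  "lattice_count S y = (\<integral>\<^sup>+z. indicator S (y - z) \<partial>count_space int_lattice)"

lemma lattice_count_measurable [measurable]:
  assumes [measurable]: "S \<in> sets borel"
  shows "lattice_count S \<in> borel_measurable borel"
  unfolding lattice_count_def[abs_def]
  by (intro borel_measurable_nn_integral_count_space countable_int_lattice) measurable

lemma lattice_periodic_lattice_count: "lattice_periodic (lattice_count S)"
  unfolding lattice_periodic_def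
proof (intro allI ballI)
  fix y w :: 'a assume w: "w \<in> int_lattice"
  have "bij_betw (\<lambda>z. z + w) int_lattice int_lattice"
    using w by (intro bij_betw_byWitness[where f' = "\<lambda>z. z - w"])
      (auto simp: int_lattice_def inner_add_left inner_diff_left)
  from nn_integral_bij_count_space[OF this, of "\<lambda>z. indicator S (y + w - z)"]
  show "lattice_count S (y + w) = lattice_count S y"
    by (simp add: lattice_count_def)
qed

lemma nn_integral_lattice_count:
  assumes [measurable]: "S \<in> sets borel"
  shows "(\<integral>\<^sup>+y. lattice_count S y \<partial>cell_measure) = emeasure lborel S"
  using nn_integral_lborel_unfold[of "indicator S"] by (simp add: lattice_count_def)

lemma mem_int_lattice_vec: "z \<in> (int_lattice :: (real ^ 'm) set) \<longleftrightarrow> (\<forall>i. z $ i \<in> \<int>)"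
  by (auto simp: int_lattice_def Basis_vec_def inner_axis)

lemma mem_int_lattice_mat: "z \<in> (int_lattice :: (real ^ 'm ^ 'n) set) \<longleftrightarrow> (\<forall>j i. z $ j $ i \<in> \<int>)"
  by (auto simp: int_lattice_def Basis_vec_def inner_axis)

lemma bij_betw_real_vec: "bij_betw real_vec UNIV (int_lattice :: (real ^ 'm) set)"
proof (rule bij_betw_imageI)
  show "inj (real_vec :: int ^ 'm \<Rightarrow> real ^ 'm)"
    by (rule injI) (simp add: real_vec_def vec_eq_iff)
  show "range real_vec = (int_lattice :: (real ^ 'm) set)"
  proof (intro equalityI subsetI)
    fix z :: "real ^ 'm" assume "z \<in> int_lattice"
    then have "z = real_vec (\<chi> i. \<lfloor>z $ i\<rfloor>)"
      by (auto simp: mem_int_lattice_vec real_vec_def vec_eq_iff elim!: Ints_cases dest!: spec)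
    then show "z \<in> range real_vec" by blast
  qed (auto simp: mem_int_lattice_vec real_vec_def)
qed

lemma vector_matrix_mult_nth: "(v v* x) $ i = (\<Sum>j\<in>UNIV. v $ j * x $ j $ i)"
  for v :: "real ^ 'n" and x :: "real ^ 'm ^ 'n"
  by (simp add: vector_matrix_mult_def mult.commute)

lemma linear_vector_matrix_mult: "linear (\<lambda>x :: real ^ 'm ^ 'n. v v* x)"
  by (rule linearI)
    (simp_all add: vec_eq_iff vector_matrix_mult_nth algebra_simps sum.distrib sum_distrib_left)

lemma vector_matrix_mult_measurable [measurable]:
  "(\<lambda>x :: real ^ 'm ^ 'n. v v* x) \<in> borel_measurable borel"
  by (intro borel_measurable_continuous_onI linear_continuous_on)
    (simp add: linear_conv_bounded_linear[symmetric] linear_vector_matrix_mult)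

lemma vector_matrix_mult_int_lattice:
  assumes "z \<in> int_lattice"
  shows "real_vec q v* z \<in> int_lattice"
  using assms unfolding mem_int_lattice_vec mem_int_lattice_mat vector_matrix_mult_nth
  by (auto intro!: Ints_sum Ints_mult simp: real_vec_def)

lemma lattice_periodic_vector_matrix_mult:
  assumes "lattice_periodic g"
  shows "lattice_periodic (\<lambda>x. g (real_vec q v* x))"
  using assms unfolding lattice_periodic_def
  by (simp add: linear_add[OF linear_vector_matrix_mult] vector_matrix_mult_int_lattice)

lemma vector_matrix_mult_surj:
  fixes q :: "real ^ 'n" and u :: "real ^ 'm"
  assumes "q \<noteq> 0"
  shows "\<exists>t. q v* t = u"
proof -
  obtain j where "q $ j \<noteq> 0" using assms by (auto simp: vec_eq_iff)
  \<comment> \<open>Row \<open>j\<close> carries all of \<open>u\<close>, divided by the nonzero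
    entry \<open>q $ j\<close>.\<close>
  then have "q v* (\<chi> l. if l = j then (1 / q $ j) *\<^sub>R u else 0) = u"
    by (simp add: vec_eq_iff vector_matrix_mult_nth if_distrib[of "\<lambda>v. v $ _"] if_distrib[of "\<lambda>c. _ * c"]
        cong: if_cong)
  then show ?thesis by blast
qed

lemma vector_matrix_mult_surj_kernel:
  fixes q r :: "real ^ 'n" and u :: "real ^ 'm"
  assumes D: "q $ i * r $ j - q $ j * r $ i \<noteq> 0"
  shows "\<exists>t. q v* t = u \<and> r v* t = 0"
proof -
  define D where "D = q $ i * r $ j - q $ j * r $ i"
  \<comment> \<open>Cramer's rule for the system \<open>q v* t = u\<close>,
    \<open>r v* t = 0\<close>, solved in rows \<open>i\<close> and \<open>j\<close> with determinant
    \<open>D\<close>; the other rows are zero.\<close>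
  define t where "t = (\<chi> l. (if l = i then (r $ j / D) *\<^sub>R u else 0) + (if l = j then (- r $ i / D) *\<^sub>R u else 0))"
  have t: "(v v* t) $ c = (v $ i * r $ j - v $ j * r $ i) / D * u $ c" for v c
    by (simp add: t_def vector_matrix_mult_nth if_distrib[of "\<lambda>v. v $ _"] if_distrib[of "\<lambda>c. _ * c"]
        ring_distribs sum.distrib diff_divide_distrib cong: if_cong)
  have "q v* t = u" "r v* t = 0"
    using D by (simp_all add: vec_eq_iff t D_def)
  then show ?thesis by blast
qed

text \<open>Equidistribution of \<open>q x\<close> modulo one: the averaging lemma with constant
  second factor, since \<open>q x\<close> can be moved to any position.\<close>

lemma nn_integral_vector_matrix_mult:
  fixes g :: "real ^ 'm \<Rightarrow> ennreal" and q :: "int ^ 'n"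
  assumes [measurable]: "g \<in> borel_measurable borel" and g: "lattice_periodic g" and "q \<noteq> 0"
  shows "(\<integral>\<^sup>+x. g (real_vec q v* x) \<partial>cell_measure) = (\<integral>\<^sup>+y. g y \<partial>cell_measure)"
proof -
  have "real_vec q \<noteq> 0" using \<open>q \<noteq> 0\<close> by (simp add: real_vec_def vec_eq_iff)
  then have "\<exists>t :: real ^ 'm ^ 'n. real_vec q v* t = u" for u
    by (rule vector_matrix_mult_surj)
  then have "(\<integral>\<^sup>+x. g (real_vec q v* x) * 1 \<partial>cell_measure) =
      (\<integral>\<^sup>+y. g y \<partial>cell_measure) * (\<integral>\<^sup>+x. 1 \<partial>(cell_measure :: (real ^ 'm ^ 'n) measure))"
    using lattice_periodic_vector_matrix_mult[OF g, of q]
    by (intro nn_integral_cell_measure_average linear_vector_matrix_mult g) auto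
  then show ?thesis
    using prob_space.emeasure_space_1[OF prob_space_cell_measure[where 'a = "real ^ 'm ^ 'n"]] by simp
qed

text \<open>Independence of \<open>q x\<close> and \<open>r x\<close> modulo one: a nonzero minor
  allows \<open>q x\<close> to be shifted arbitrarily by some \<open>t\<close> with
  \<open>r t = 0\<close>, which leaves the second factor unchanged.\<close>

lemma nn_integral_vector_matrix_mult_pair:
  fixes g h :: "real ^ 'm \<Rightarrow> ennreal" and q r :: "int ^ 'n"
  assumes [measurable]: "g \<in> borel_measurable borel" "h \<in> borel_measurable borel"
    and g: "lattice_periodic g" and h: "lattice_periodic h"
    and D: "q $ i * r $ j - q $ j * r $ i \<noteq> 0"
  shows "(\<integral>\<^sup>+x. g (real_vec q v* x) * h (real_vec r v* x) \<partial>cell_measure) =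
    (\<integral>\<^sup>+y. g y \<partial>cell_measure) * (\<integral>\<^sup>+y. h y \<partial>cell_measure)"
proof -
  have "r \<noteq> 0"
  proof
    assume "r = 0"
    then show False using D by simp
  qed
  have "of_int (q $ i * r $ j - q $ j * r $ i) \<noteq> (0 :: real)" using D by (metis of_int_eq_0_iff)
  then have D': "real_vec q $ i * real_vec r $ j - real_vec q $ j * real_vec r $ i \<noteq> 0"
    by (simp add: real_vec_def)
  have per: "lattice_periodic (\<lambda>x. g (real_vec q v* x) * h (real_vec r v* x))"
    using lattice_periodic_vector_matrix_mult[OF g, of q] lattice_periodic_vector_matrix_mult[OF h, of r]
    by (simp add: lattice_periodic_def)
  have "\<exists>t. real_vec q v* t = u \<and> (\<forall>x. h (real_vec r v* (x + t)) = h (real_vec r v* x))" for u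
  proof -
    obtain t where "real_vec q v* t = u" "real_vec r v* t = 0"
      using vector_matrix_mult_surj_kernel[OF D'] by blast
    then show ?thesis by (auto simp: linear_add[OF linear_vector_matrix_mult] intro!: exI[of _ t])
  qed
  then have "(\<integral>\<^sup>+x. g (real_vec q v* x) * h (real_vec r v* x) \<partial>cell_measure) =
      (\<integral>\<^sup>+y. g y \<partial>cell_measure) * (\<integral>\<^sup>+x. h (real_vec r v* x) \<partial>cell_measure)"
    by (intro nn_integral_cell_measure_average linear_vector_matrix_mult g per) auto
  then show ?thesis
    by (simp add: nn_integral_vector_matrix_mult h \<open>r \<noteq> 0\<close>)
qed

section \<open>Balls\<close>

lemma is_ball_borel_finite:
  fixes S :: "(real ^ 'm) set"
  assumes N: "N = norm \<or> N = infnorm" and "is_ball N S"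
  shows "S \<in> sets borel" and "emeasure lborel S < \<infinity>"
proof -
  have cont: "continuous_on UNIV (\<lambda>y. N (y - c))" for c
    using N by (auto intro!: continuous_intros)
  have coord: "\<bar>y \<bullet> b\<bar> \<le> N y" if "b \<in> Basis" for y b
    using N that by (auto simp: Basis_le_norm Basis_le_infnorm)
  obtain c r where S: "S = {y. N (y - c) < r} \<or> S = {y. N (y - c) \<le> r}"
    using assms(2) by (auto simp: is_ball_def)
  have [measurable]: "(\<lambda>y. N (y - c)) \<in> borel_measurable borel"
    using cont by (rule borel_measurable_continuous_onI)
  show "S \<in> sets borel"
    using S by (elim disjE) simp_all
  have "S \<subseteq> cbox (c - r *\<^sub>R One) (c + r *\<^sub>R One)"
  proof
    fix y assume "y \<in> S"
    then have "N (y - c) \<le> r" using S by auto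
    then have "\<bar>(y - c) \<bullet> b\<bar> \<le> r" if "b \<in> Basis" for b
      using coord[OF that, of "y - c"] by linarith
    then show "y \<in> cbox (c - r *\<^sub>R One) (c + r *\<^sub>R One)"
      by (auto simp: mem_box algebra_simps abs_le_iff)
  qed
  then have "emeasure lborel S \<le> emeasure lborel (cbox (c - r *\<^sub>R One) (c + r *\<^sub>R One))"
    by (intro emeasure_mono) auto
  also have "\<dots> < \<infinity>" by (rule emeasure_lborel_cbox_finite)
  finally show "emeasure lborel S < \<infinity>" .
qed

text \<open>A ball of radius above 1/4 is replaced by the concentric open ball of radius 1/4, whose
  measure \<open>c0\<close> does not depend on the centre. Two points of the resulting set differ by
  at most 1/2 in each coordinate, so they cannot differ by a nonzero integer vector.\<close>

lemma is_ball_shrink: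
  fixes N :: "real ^ 'm \<Rightarrow> real"
  assumes N: "N = norm \<or> N = infnorm"
  shows "\<exists>c0>0. \<forall>S. is_ball N S \<longrightarrow> (\<exists>S'\<subseteq>S. S' \<in> sets borel \<and>
    min (measure lborel S) c0 \<le> measure lborel S' \<and>
    (\<forall>y. \<forall>z\<in>int_lattice. y \<in> S' \<longrightarrow> y - z \<in> S' \<longrightarrow> z = 0))"
proof -
  define U where "U c = {y. N (y - c) < 1 / 4}" for c
  have cont: "continuous_on UNIV (\<lambda>y. N (y - c))" for c
    using N by (auto intro!: continuous_intros)
  have coord: "\<bar>y \<bullet> b\<bar> \<le> N y" if "b \<in> Basis" for y b
    using N that by (auto simp: Basis_le_norm Basis_le_infnorm)
  have ball: "is_ball N (U c)" for c
    unfolding is_ball_def U_def by (intro exI[of _ c] exI[of _ "1 / 4"]) auto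
  have "open (U 0)"
    unfolding U_def by (intro open_Collect_less cont continuous_intros)
  moreover have "0 \<in> U 0" using N by (auto simp: U_def infnorm_0)
  ultimately have "U 0 \<notin> null_sets lebesgue"
    using open_not_negligible[of "U 0"] by (auto simp: negligible_iff_null_sets)
  then have "emeasure lborel (U 0) \<noteq> 0"
    using is_ball_borel_finite(1)[OF N ball, of 0]
    by (metis null_setsI null_sets_completionI sets_lborel)
  then have pos: "0 < measure lborel (U 0)"
    using is_ball_borel_finite[OF N ball, of 0]
    by (simp add: measure_def enn2real_positive_iff zero_less_iff_neq_zero)
  have translate: "measure lborel (U c) = measure lborel (U 0)" for c
  proof -
    note [measurable] = is_ball_borel_finite(1)[OF N ball]
    have "indicator (U c) (x + c) = (indicator (U 0) x :: ennreal)" for x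
      by (simp add: U_def indicator_def)
    then have "emeasure lborel (U c) = emeasure lborel (U 0)"
      using nn_integral_lborel_shift[of "indicator (U c)" c] by simp
    then show ?thesis by (simp add: measure_def)
  qed
  have disj: "z = 0" if st: "S \<subseteq> {y. N (y - c) \<le> 1 / 4}" "z \<in> int_lattice" "y \<in> S" "y - z \<in> S" for S c y z
  proof (rule euclidean_eqI)
    fix b :: "real ^ 'm" assume b: "b \<in> Basis"
    obtain k where k: "z \<bullet> b = of_int k"
      using st(2) b by (auto simp: int_lattice_def elim: Ints_cases)
    have "\<bar>(y - c) \<bullet> b\<bar> \<le> 1 / 4" "\<bar>(y - z - c) \<bullet> b\<bar> \<le> 1 / 4"
      using st coord[OF b] by (meson order_trans subsetD mem_Collect_eq)+
    then have "\<bar>real_of_int k\<bar> < 1" using k unfolding inner_diff_left by linarith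
    then show "z \<bullet> b = 0 \<bullet> b" using k by simp
  qed
  have "\<exists>S'\<subseteq>S. S' \<in> sets borel \<and> min (measure lborel S) (measure lborel (U 0)) \<le> measure lborel S' \<and>
    (\<forall>y. \<forall>z\<in>int_lattice. y \<in> S' \<longrightarrow> y - z \<in> S' \<longrightarrow> z = 0)" if S: "is_ball N S" for S
  proof -
    obtain c r where cr: "S = {y. N (y - c) < r} \<or> S = {y. N (y - c) \<le> r}"
      using S by (auto simp: is_ball_def)
    show ?thesis
    proof (cases "r \<le> 1 / 4")
      case True
      then have "S \<subseteq> {y. N (y - c) \<le> 1 / 4}" using cr by auto
      then show ?thesis using disj is_ball_borel_finite(1)[OF N S] by (intro exI[of _ S]) auto
    next
      case False
      have "U c \<subseteq> {y. N (y - c) \<le> 1 / 4}" by (auto simp: U_def)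
      moreover have "U c \<subseteq> S" using False cr by (auto simp: U_def)
      ultimately show ?thesis
        using disj is_ball_borel_finite(1)[OF N ball] translate[of c] by (intro exI[of _ "U c"]) auto
    qed
  qed
  then show ?thesis using pos by blast
qed

text \<open>Disjointness of the integer translates makes the count 0 or 1, so that its mean becomes
  the probability of an event.\<close>

lemma lattice_count_eq_indicator:
  assumes "\<And>y z. z \<in> int_lattice \<Longrightarrow> y \<in> S \<Longrightarrow> y - z \<in> S \<Longrightarrow> z = 0"
  shows "lattice_count S y = indicator {y. \<exists>z\<in>int_lattice. y - z \<in> S} y"
proof (cases "\<exists>z\<in>int_lattice. y - z \<in> S")
  case True
  then obtain z where z: "z \<in> int_lattice" "y - z \<in> S" by blast
  have "w = z" if w: "w \<in> int_lattice" "y - w \<in> S" for w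
  proof -
    have "w - z \<in> int_lattice" using w z by (simp add: int_lattice_def inner_diff_left)
    moreover have "(y - z) - (w - z) \<in> S" using w by simp
    ultimately have "w - z = 0" using assms z(2) by blast
    then show ?thesis by simp
  qed
  then have "\<exists>!z. z \<in> int_lattice \<and> y - z \<in> S" using z by blast
  then have "(\<integral>\<^sup>+z. indicator {z. y - z \<in> S} z \<partial>count_space int_lattice) = 1"
    by (rule nn_integral_count_space_indicator_unique)
  moreover have "indicator {z. y - z \<in> S} z = (indicator S (y - z) :: ennreal)" for z
    by (simp add: indicator_def)
  ultimately show ?thesis using True by (simp add: lattice_count_def)
next
  case False
  then have "lattice_count S y = (\<integral>\<^sup>+z. 0 \<partial>(count_space int_lattice :: 'a measure))"
    unfolding lattice_count_def by (intro nn_integral_cong) auto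
  then show ?thesis using False by simp
qed

section \<open>Approximation of linear forms\<close>

text \<open>\<open>H x\<close> counts all pairs with \<open>q x - p\<close> in the ball, coprime or
  not. Its mean over the cell is the sum of the measures of the \<open>B (max_norm q)\<close>, which
  is finite, so \<open>H\<close> is finite almost everywhere on the cell and, by periodicity, in the
  whole space.\<close>

lemma AE_finite_solutions:
  fixes B :: "nat \<Rightarrow> (real ^ 'm) set"
  assumes B: "\<And>k. k \<ge> 1 \<Longrightarrow> B k \<in> sets borel" and fin: "\<And>k. k \<ge> 1 \<Longrightarrow> emeasure lborel (B k) < \<infinity>"
    and sum: "summable (\<lambda>k. real k ^ (CARD('n::finite) - 1) * measure lborel (B k))"
  shows "AE x :: real ^ 'm ^ 'n in lborel. finite (solutions B x)"
proof -
  let ?I = "UNIV - {0 :: int ^ 'n}"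
  define H where "H x = (\<integral>\<^sup>+q. lattice_count (B (max_norm q)) (real_vec q v* x) \<partial>count_space ?I)"
    for x :: "real ^ 'm ^ 'n"
  have pos: "max_norm q \<ge> 1" if "q \<noteq> 0" for q :: "int ^ 'n"
    using that max_norm_eq_0_iff[of q] by linarith
  have B': "B (max_norm q) \<in> sets borel" if "q \<noteq> 0" for q :: "int ^ 'n"
    using that by (intro B pos)
  have meas: "(\<lambda>x :: real ^ 'm ^ 'n. lattice_count (B (max_norm q)) (real_vec q v* x)) \<in> borel_measurable borel"
    if "q \<in> ?I" for q :: "int ^ 'n"
  proof -
    have [measurable]: "B (max_norm q) \<in> sets borel" using that by (intro B') auto
    show ?thesis by measurable
  qed
  have H_meas [measurable]: "H \<in> borel_measurable borel"
    unfolding H_def[abs_def] by (intro borel_measurable_nn_integral_count_space meas) auto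
  have H_per: "lattice_periodic H"
    unfolding lattice_periodic_def
  proof (intro allI ballI)
    fix x z :: "real ^ 'm ^ 'n" assume z: "z \<in> int_lattice"
    show "H (x + z) = H x"
      unfolding H_def
      by (intro nn_integral_cong lattice_periodic_add[OF _ z]
          lattice_periodic_vector_matrix_mult lattice_periodic_lattice_count)
  qed
  have "(\<integral>\<^sup>+x. H x \<partial>cell_measure) =
      (\<integral>\<^sup>+q. (\<integral>\<^sup>+x. lattice_count (B (max_norm q)) (real_vec q v* x) \<partial>(cell_measure :: (real ^ 'm ^ 'n) measure)) \<partial>count_space ?I)"
    unfolding H_def using meas by (intro nn_integral_count_space_nn_integral) auto
  also have "\<dots> = (\<integral>\<^sup>+q. ennreal (measure lborel (B (max_norm q))) \<partial>count_space ?I)"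
  proof (rule nn_integral_cong)
    fix q assume "q \<in> space (count_space ?I)"
    then have q: "q \<noteq> 0" by simp
    note [measurable] = B'[OF q]
    show "(\<integral>\<^sup>+x. lattice_count (B (max_norm q)) (real_vec q v* x) \<partial>(cell_measure :: (real ^ 'm ^ 'n) measure)) =
        ennreal (measure lborel (B (max_norm q)))"
      using fin[OF pos[OF q]]
      by (simp add: nn_integral_vector_matrix_mult lattice_periodic_lattice_count q
          nn_integral_lattice_count emeasure_eq_ennreal_measure)
  qed
  also have "\<dots> < \<infinity>"
    by (rule nn_integral_max_norm_finite[OF _ sum]) simp
  finally have "AE x in cell_measure. H x \<noteq> \<infinity>"
    by (intro nn_integral_PInf_AE) auto
  moreover have "lattice_periodic (\<lambda>x. H x \<noteq> \<infinity>)"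
    using H_per by (simp add: lattice_periodic_def)
  ultimately have "AE x in lborel. H x \<noteq> \<infinity>"
    by (intro AE_lborel_if_AE_cell_measure) auto
  then show ?thesis
  proof eventually_elim
    fix x assume H: "H x \<noteq> \<infinity>"
    \<comment> \<open>Here \<open>q\<close> comes first, matching the order of the iterated
      integral; \<open>solutions\<close> lists \<open>p\<close> first, whence the swap
      below.\<close>
    define T where "T = {(q, p). q \<noteq> 0 \<and> real_vec q v* x - real_vec p \<in> B (max_norm q)}"
    have "lattice_count (B (max_norm q)) (real_vec q v* x) =
        (\<integral>\<^sup>+p. indicator (B (max_norm q)) (real_vec q v* x - real_vec p) \<partial>count_space UNIV)" for q
      unfolding lattice_count_def by (rule nn_integral_bij_count_space[OF bij_betw_real_vec, symmetric])
    then have "H x = (\<integral>\<^sup>+q. (\<integral>\<^sup>+p. indicator (B (max_norm q)) (real_vec q v* x - real_vec p)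
        \<partial>count_space UNIV) * indicator ?I q \<partial>count_space UNIV)"
      unfolding H_def by (simp add: nn_integral_count_space_indicator)
    also have "\<dots> = (\<integral>\<^sup>+q. (\<integral>\<^sup>+p. indicator T (q, p) \<partial>count_space UNIV) \<partial>count_space UNIV)"
      by (intro nn_integral_cong, subst nn_integral_multc[symmetric])
        (auto intro!: nn_integral_cong simp: T_def indicator_def)
    also have "\<dots> = (\<integral>\<^sup>+y. indicator T y \<partial>count_space UNIV)"
      by (rule nn_integral_fst_count_space)
    also have "\<dots> = emeasure (count_space UNIV) T"
      by simp
    finally have "finite T" using H by (cases "finite T") auto
    moreover have "solutions B x \<subseteq> prod.swap ` T"
      by (auto simp: solutions_def T_def image_iff)
    ultimately show "finite (solutions B x)"
      by (meson finite_imageI finite_subset)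
  qed
qed

lemma AE_infinite_solutions:
  fixes B :: "nat \<Rightarrow> (real ^ 'm) set"
  assumes n: "CARD('n::finite) > 2" and N: "N = norm \<or> N = infnorm"
    and ball: "\<And>k. k \<ge> 1 \<Longrightarrow> is_ball N (B k)"
    and div: "\<not> summable (\<lambda>k. real k ^ (CARD('n) - 1) * measure lborel (B k))"
  shows "AE x :: real ^ 'm ^ 'n in lborel. infinite (solutions B x)"
proof -
  obtain c where c: "c > 0" and shrink: "\<And>S. is_ball N S \<Longrightarrow> \<exists>S'\<subseteq>S. S' \<in> sets borel \<and>
      min (measure lborel S) c \<le> measure lborel S' \<and>
      (\<forall>y. \<forall>z\<in>int_lattice. y \<in> S' \<longrightarrow> y - z \<in> S' \<longrightarrow> z = 0)"
    using is_ball_shrink[OF N] by blast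
  have "\<forall>k. \<exists>S'. k \<ge> 1 \<longrightarrow> S' \<subseteq> B k \<and> S' \<in> sets borel \<and> min (measure lborel (B k)) c \<le> measure lborel S' \<and>
      (\<forall>y. \<forall>z\<in>int_lattice. y \<in> S' \<longrightarrow> y - z \<in> S' \<longrightarrow> z = 0)"
    using shrink[OF ball] by blast
  from choice[OF this] obtain B' where B0: "\<And>k. k \<ge> 1 \<Longrightarrow> B' k \<subseteq> B k \<and> B' k \<in> sets borel \<and>
      min (measure lborel (B k)) c \<le> measure lborel (B' k) \<and>
      (\<forall>y. \<forall>z\<in>int_lattice. y \<in> B' k \<longrightarrow> y - z \<in> B' k \<longrightarrow> z = 0)"
    by blast
  then have B': "\<And>k. k \<ge> 1 \<Longrightarrow> B' k \<subseteq> B k" "\<And>k. k \<ge> 1 \<Longrightarrow> B' k \<in> sets borel"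
      "\<And>k. k \<ge> 1 \<Longrightarrow> min (measure lborel (B k)) c \<le> measure lborel (B' k)"
      "\<And>k y z. k \<ge> 1 \<Longrightarrow> z \<in> int_lattice \<Longrightarrow> y \<in> B' k \<Longrightarrow> y - z \<in> B' k \<Longrightarrow> z = 0"
    by blast+
  \<comment> \<open>The union of the integer translates of the shrunken ball: \<open>q x\<close>
    lies in it exactly when some \<open>p\<close> puts \<open>q x - p\<close> into
    \<open>B' k\<close>.\<close>
  define E where "E k = {y. \<exists>z\<in>int_lattice. y - z \<in> B' k}" for k
  have count: "lattice_count (B' k) = indicator (E k)" if "k \<ge> 1" for k
    unfolding E_def using B'(4)[OF that] by (intro ext lattice_count_eq_indicator) auto
  have ind_meas: "(indicator (E k) :: _ \<Rightarrow> ennreal) \<in> borel_measurable borel" if "k \<ge> 1" for k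
    using lattice_count_measurable[OF B'(2)[OF that]] unfolding count[OF that] .
  have E_meas: "E k \<in> sets borel" if "k \<ge> 1" for k
    using ind_meas[OF that] by (simp add: borel_measurable_indicator_iff)
  have ind_per: "lattice_periodic (indicator (E k) :: _ \<Rightarrow> ennreal)" if "k \<ge> 1" for k
    using lattice_periodic_lattice_count[of "B' k"] unfolding count[OF that] .
  have E_per: "lattice_periodic (\<lambda>y. y \<in> E k)" if "k \<ge> 1" for k
    using ind_per[OF that] unfolding lattice_periodic_def indicator_def of_bool_eq_iff .
  have E_int: "(\<integral>\<^sup>+y. indicator (E k) y \<partial>cell_measure) = ennreal (measure lborel (B' k))" if "k \<ge> 1" for k
  proof -
    have "emeasure lborel (B' k) \<le> emeasure lborel (B k)"
      using B'(1)[OF that] is_ball_borel_finite(1)[OF N ball[OF that]] by (intro emeasure_mono) auto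
    then have "emeasure lborel (B' k) < \<infinity>"
      using is_ball_borel_finite(2)[OF N ball[OF that]] by order
    then show ?thesis
      using nn_integral_lattice_count[OF B'(2)[OF that]]
      by (simp add: count[OF that] emeasure_eq_ennreal_measure)
  qed

  \<comment> \<open>Any coordinate will do; it is the one at which all vectors in \<open>I\<close>
    attain their norm.\<close>
  obtain i :: 'n where True by simp
  define I where "I = (\<Union>k. primitive_sphere i k)"
  have I: "max_norm q \<ge> 1" "q \<noteq> 0" "gcd_vec q = 1" if "q \<in> I" for q
  proof -
    obtain k where k: "q \<in> primitive_sphere i k" using \<open>q \<in> I\<close> by (auto simp: I_def)
    then show "q \<noteq> 0" "gcd_vec q = 1" by (auto simp: primitive_sphere_def dest: spec[of _ i])
    then show "max_norm q \<ge> 1" using max_norm_eq_0_iff[of q] by linarith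
  qed
  define A where "A q = {x :: real ^ 'm ^ 'n. real_vec q v* x \<in> E (max_norm q)}" for q
  interpret prob_space "cell_measure :: (real ^ 'm ^ 'n) measure"
    by (rule prob_space_cell_measure)
  have A_meas: "A q \<in> sets borel" if "q \<in> I" for q
  proof -
    note [measurable] = E_meas[OF I(1)[OF that]]
    show ?thesis unfolding A_def by measurable
  qed
  have A_ind: "indicator (A q) x = (indicator (E (max_norm q)) (real_vec q v* x) :: ennreal)" for q x
    by (simp add: A_def indicator_def)
  have emeasure_A: "emeasure cell_measure (A q) = ennreal (measure lborel (B' (max_norm q)))" if "q \<in> I" for q
  proof -
    have "emeasure cell_measure (A q) = (\<integral>\<^sup>+x. indicator (A q) x \<partial>cell_measure)"
      using A_meas[OF that] by simp
    also have "\<dots> = (\<integral>\<^sup>+y. indicator (E (max_norm q)) y \<partial>cell_measure)"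
      unfolding A_ind using I[OF that]
      by (intro nn_integral_vector_matrix_mult ind_meas ind_per) auto
    finally show ?thesis using E_int I(1)[OF that] by simp
  qed
  then have prob_A: "prob (A q) = measure lborel (B' (max_norm q))" if "q \<in> I" for q
    using that by (simp add: measure_def)
  have indep: "prob (A q \<inter> A r) = prob (A q) * prob (A r)" if q: "q \<in> I" and r: "r \<in> I" and "q \<noteq> r" for q r
  proof -
    obtain j where j: "q $ i * r $ j - q $ j * r $ i \<noteq> 0"
      using primitive_spheres_minor_nonzero q r \<open>q \<noteq> r\<close> unfolding I_def by blast
    have "emeasure cell_measure (A q \<inter> A r) = (\<integral>\<^sup>+x. indicator (A q \<inter> A r) x \<partial>cell_measure)"
      using A_meas[OF q] A_meas[OF r] by (intro nn_integral_indicator[symmetric]) auto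
    also have "\<dots> = (\<integral>\<^sup>+y. indicator (E (max_norm q)) y \<partial>cell_measure) * (\<integral>\<^sup>+y. indicator (E (max_norm r)) y \<partial>cell_measure)"
      unfolding indicator_inter_arith A_ind using I(1)[OF q] I(1)[OF r]
      by (intro nn_integral_vector_matrix_mult_pair[OF _ _ _ _ j] ind_meas ind_per)
    also have "\<dots> = ennreal (measure lborel (B' (max_norm q)) * measure lborel (B' (max_norm r)))"
      using E_int I(1)[OF q] I(1)[OF r] by (simp add: ennreal_mult)
    finally show ?thesis
      by (simp add: measure_def[of cell_measure "A q \<inter> A r"] prob_A q r)
  qed
  have unbounded: "\<exists>F. finite F \<and> F \<subseteq> I \<and> K \<le> (\<Sum>q\<in>F. prob (A q))" for K
  proof -
    have "\<not> summable (\<lambda>k. real k ^ (CARD('n) - 1) * measure lborel (B' k))"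
      by (rule not_summable_truncate[OF div c]) (auto intro: B'(3))
    then obtain F where F: "finite F" "F \<subseteq> I" "K \<le> (\<Sum>q\<in>F. measure lborel (B' (max_norm q)))"
      using sum_primitive_spheres_unbounded[OF n, of "\<lambda>k. measure lborel (B' k)" i K]
      unfolding I_def by auto
    moreover have "(\<Sum>q\<in>F. measure lborel (B' (max_norm q))) = (\<Sum>q\<in>F. prob (A q))"
      using F(2) by (intro sum.cong refl prob_A[symmetric]) auto
    ultimately show ?thesis by auto
  qed
  have "AE x in cell_measure. infinite {q \<in> I. x \<in> A q}"
    by (rule AE_infinite_if_pairwise_indep) (use A_meas indep unbounded in auto)
  moreover have "Measurable.pred borel (\<lambda>x. infinite {q \<in> I. x \<in> A q})"
  proof -
    have [measurable]: "(\<lambda>x. \<integral>\<^sup>+q. indicator (A q) x \<partial>count_space I) \<in> borel_measurable borel"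
      by (intro borel_measurable_nn_integral_count_space borel_measurable_indicator A_meas) auto
    \<comment> \<open>Infinitude is expressed as a count equal to infinity, which is a measurable
      condition.\<close>
    have "infinite {q \<in> I. x \<in> A q} \<longleftrightarrow> (\<integral>\<^sup>+q. indicator (A q) x \<partial>count_space I) = \<infinity>" for x
    proof -
      have "(\<integral>\<^sup>+q. indicator (A q) x \<partial>count_space I) = (\<integral>\<^sup>+q. indicator {q \<in> I. x \<in> A q} q \<partial>count_space I)"
        by (intro nn_integral_cong) (auto simp: indicator_def)
      also have "\<dots> = emeasure (count_space I) {q \<in> I. x \<in> A q}"
        by (intro nn_integral_indicator) auto
      finally show ?thesis by (auto simp: emeasure_count_space)
    qed
    then show ?thesis by simp
  qed
  moreover have "lattice_periodic (\<lambda>x. infinite {q \<in> I. x \<in> A q})"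
  proof -
    have "x + z \<in> A q \<longleftrightarrow> x \<in> A q" if "q \<in> I" "z \<in> int_lattice" for q x z
      using lattice_periodic_add[OF lattice_periodic_vector_matrix_mult[OF E_per[OF I(1)[OF that(1)]]] that(2)]
      by (simp add: A_def)
    then show ?thesis
      unfolding lattice_periodic_def by (metis (no_types, lifting) Collect_cong)
  qed
  ultimately have "AE x in lborel. infinite {q \<in> I. x \<in> A q}"
    by (rule AE_lborel_if_AE_cell_measure[rotated 2])
  then show ?thesis
  proof eventually_elim
    fix x assume inf: "infinite {q \<in> I. x \<in> A q}"
    \<comment> \<open>Each such \<open>q\<close> has at least one partner \<open>p\<close>. Since
      \<open>q\<close> is primitive, the coprimality condition holds for every choice of
      \<open>p\<close>.\<close>
    have "{q \<in> I. x \<in> A q} \<subseteq> snd ` solutions B x"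
    proof
      fix q assume "q \<in> {q \<in> I. x \<in> A q}"
      then have q: "q \<in> I" "x \<in> A q" by auto
      then obtain z where z: "z \<in> int_lattice" "real_vec q v* x - z \<in> B' (max_norm q)"
        by (auto simp: A_def E_def)
      then obtain p where p: "z = real_vec p"
        using bij_betw_real_vec by (metis bij_betw_imp_surj_on imageE)
      have "Gcd (range (\<lambda>j. q $ j)) = 1"
        using I(3)[OF q(1)] by (simp add: gcd_vec_def nat_eq_iff)
      then have "(p, q) \<in> solutions B x"
        using I[OF q(1)] B'(1) z(2) p by (auto simp: solutions_def)
      then show "q \<in> snd ` solutions B x" by force
    qed
    then show "infinite (solutions B x)"
      using inf finite_subset by blast
  qed
qed

section \<open>Reduction of the weighted series to the radial series, and the dichotomy\<close>

theorem theorem7p5: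
  fixes B :: "nat \<Rightarrow> (real ^ 'm) set"
    and N :: "real ^ 'm \<Rightarrow> real"
  assumes "CARD('n::finite) > 2"
    and "N = norm \<or> N = infnorm"
    and "\<And>k. k \<ge> 1 \<Longrightarrow> is_ball N (B k)"
  shows "(measure_sum TYPE('n) B = \<infinity> \<longrightarrow>
            (AE x :: real ^ 'm ^ 'n in lebesgue. infinite (solutions B x)))
       \<and> (measure_sum TYPE('n) B < \<infinity> \<longrightarrow>
            (AE x :: real ^ 'm ^ 'n in lebesgue. finite (solutions B x)))"
proof -
  let ?I = "UNIV - {0 :: int ^ 'n}"
  define a where "a k = measure lborel (B k)" for k
  define f where "f q = ennreal ((real (totient (gcd_vec q)) / real (gcd_vec q)) ^ CARD('m))
      * emeasure lebesgue (B (max_norm q))" for q :: "int ^ 'n"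
  have sum_f: "measure_sum TYPE('n) B = infsum f ?I"
    unfolding measure_sum_def by (rule infsum_cong) (simp add: f_def)
  have borel: "B k \<in> sets borel" "emeasure lborel (B k) < \<infinity>" if "k \<ge> 1" for k
    using is_ball_borel_finite[OF assms(2,3)] that by auto
  have emeasure_B: "emeasure lebesgue (B (max_norm q)) = ennreal (a (max_norm q))" if "q \<noteq> 0" for q :: "int ^ 'n"
  proof -
    have "max_norm q \<ge> 1" using that max_norm_eq_0_iff[of q] by linarith
    then show ?thesis using borel[of "max_norm q"] by (simp add: a_def emeasure_eq_ennreal_measure)
  qed
  \<comment> \<open>The totient quotient is at most 1, so the weighted series is dominated by the
    unweighted one.\<close>
  have f_le: "f q \<le> ennreal (a (max_norm q))" if "q \<noteq> 0" for q
  proof -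
    have "real (totient (gcd_vec q)) / real (gcd_vec q) \<le> 1"
      using totient_le[of "gcd_vec q"] by (auto simp: divide_le_eq_1)
    then have "ennreal ((real (totient (gcd_vec q)) / real (gcd_vec q)) ^ CARD('m)) \<le> 1"
      by (intro ennreal_le_1[THEN iffD2] power_le_one) auto
    then have "f q \<le> 1 * ennreal (a (max_norm q))"
      unfolding f_def emeasure_B[OF that] by (rule mult_right_mono) simp
    then show ?thesis by simp
  qed
  have sum_finite: "measure_sum TYPE('n) B < \<infinity>" if "summable (\<lambda>k. real k ^ (CARD('n) - 1) * a k)"
  proof -
    have "measure_sum TYPE('n) B \<le> (\<integral>\<^sup>+q. f q \<partial>count_space ?I)"
      unfolding sum_f by (rule infsum_ennreal_le_nn_integral)
    also have "\<dots> \<le> (\<integral>\<^sup>+q. ennreal (a (max_norm q)) \<partial>count_space ?I)"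
      using f_le by (intro nn_integral_mono) auto
    also have "\<dots> < \<infinity>"
      by (rule nn_integral_max_norm_finite[OF _ that]) (simp add: a_def)
    finally show ?thesis .
  qed
  have sum_infinite: "measure_sum TYPE('n) B = \<infinity>" if div: "\<not> summable (\<lambda>k. real k ^ (CARD('n) - 1) * a k)"
  proof (rule ccontr)
    assume "measure_sum TYPE('n) B \<noteq> \<infinity>"
    then obtain K where K: "0 \<le> K" "measure_sum TYPE('n) B = ennreal K"
      by (cases "measure_sum TYPE('n) B") auto
    obtain i :: 'n where True by simp
    obtain F where F: "finite F" "F \<subseteq> (\<Union>k. primitive_sphere i k)" "K + 1 \<le> (\<Sum>q\<in>F. a (max_norm q))"
      using sum_primitive_spheres_unbounded[OF assms(1) _ div, of i "K + 1"] by (auto simp: a_def)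
    have F': "q \<noteq> 0" "gcd_vec q = 1" if "q \<in> F" for q
      using that F(2) by (auto simp: primitive_sphere_def subset_iff dest!: bspec spec[of _ i])
    have "ennreal (K + 1) \<le> ennreal (\<Sum>q\<in>F. a (max_norm q))"
      using F(3) by (rule ennreal_leI)
    also have "\<dots> = (\<Sum>q\<in>F. ennreal (a (max_norm q)))"
      by (rule sum_ennreal[symmetric]) (simp add: a_def)
    \<comment> \<open>On primitive vectors the weight is \<open>totient 1 / 1 = 1\<close>.\<close>
    also have "\<dots> = sum f F"
      using F' by (intro sum.cong refl) (simp add: f_def emeasure_B)
    also have "\<dots> \<le> measure_sum TYPE('n) B"
      unfolding sum_f using F(1) F' by (intro sum_ennreal_le_infsum) auto
    finally show False using K by simp
  qed
  show ?thesis
  \<comment> \<open>Finiteness of the weighted sum is now equivalent to summability of the radial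
    series. Both almost-everywhere claims are proved for \<open>lborel\<close> and pass to its
    completion.\<close>
  proof (intro conjI impI AE_completion)
    assume "measure_sum TYPE('n) B = \<infinity>"
    then have "\<not> summable (\<lambda>k. real k ^ (CARD('n) - 1) * a k)" using sum_finite by auto
    then show "AE x :: real ^ 'm ^ 'n in lborel. infinite (solutions B x)"
      unfolding a_def by (intro AE_infinite_solutions[OF assms(1,2)] assms(3))
  next
    assume "measure_sum TYPE('n) B < \<infinity>"
    then have "summable (\<lambda>k. real k ^ (CARD('n) - 1) * a k)" using sum_infinite by fastforce
    then show "AE x :: real ^ 'm ^ 'n in lborel. finite (solutions B x)"
      unfolding a_def by (intro AE_finite_solutions borel)
  qed
qed

end
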